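(* Let $\mathbb{F}$ be an algebraically closed field of characteristic $p>2$. The Schur functor $\mathcal{S}:\mathrm{Pol}(\mathrm{GL})\to\mathbb{F}\mathfrak{S}\text{-mod}$ respects the functor transformations $X$ and $T$. That is, under the identification $E\circ\mathcal{S}\cong\mathcal{S}\circ E$ described in the context, the endomorphism of $E\mathcal{S}$ induced by the endomorphism $X$ of the functor $E$ on $\mathbb{F}\mathfrak{S}\text{-mod}$ coincides with the endomorphism of $\mathcal{S}E$ induced by the endomorphism $X$ of the functor $E$ on $\mathrm{Pol}(\mathrm{GL})$; and under the resulting identification $E^2\circ\mathcal{S}\cong\mathcal{S}\circ E^2$ the endomorphism induced by $T\in\mathrm{End}(E^2)$ on $\mathbb{F}\mathfrak{S}\text{-mod}$ coincides with the one induced by $T\in\mathrm{End}(E^2)$ on $\mathrm{Pol}(\mathrm{GL})$.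
   Context: Polynomial representations. For $d\ge0$, $\mathrm{Rep}^d(\mathrm{GL}_n)$ is the full subcategory of the category of finite dimensional rational representations of $\mathrm{GL}_n=\mathrm{GL}_n(\mathbb{F})$ consisting of the modules all of whose weights $\mu\in\mathbb{Z}^n$ (for the torus of diagonal matrices) satisfy $\mu_1,\dots,\mu_n\geqslant0$ and $\mu_1+\dots+\mu_n=d$. Let $\tau_n^{n+1}:\mathrm{Rep}^d(\mathrm{GL}_{n+1})\to\mathrm{Rep}^d(\mathrm{GL}_n)$ be the functor of invariants under the subtorus $\{\mathrm{diag}(1,\dots,1,t)\}$. For $n\ge d$ it is an equivalence; $\mathrm{Rep}^d(\mathrm{GL}):=\mathrm{Rep}^d(\mathrm{GL}_n)$ for any $n\ge d$, the categories for different $n$ being identified via the $\tau$'s. Put $\mathrm{Pol}(\mathrm{GL})=\bigoplus_{d\ge0}\mathrm{Rep}^d(\mathrm{GL})$. Data on $\mathrm{Pol}(\mathrm{GL})$. $V=\mathbb{F}^n$ is the tautological module. $F(M)=V\otimes M$; $X\in\mathrm{End}(F)$ is given by the action of $\sum_{i,j}E_{ij}\otimes E_{ji}$ ($E_{ij}$ matrix units of $\mathfrak{gl}_n$) on $V\otimes M$; $T\in\mathrm{End}(F^2)$ is given by $v_1\otimes v_2\otimes m\mapsto v_2\otimes v_1\otimes m$ on $V\otimes V\otimes M$. All of these are compatible with the $\tau$'s and so are defined on $\mathrm{Pol}(\mathrm{GL})$. $F=\bigoplus_{\alpha\in\mathbb{F}_p}F_\alpha$ with $F_\alpha$ the generalized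 $\alpha$-eigen-subfunctor of $X$; $E_\alpha$ is the left adjoint of $F_\alpha$, which is also its right adjoint, and $E=\bigoplus_\alpha E_\alpha$, so $E$ is also right adjoint to $F$. The endomorphism $X$ of $E$ is the one corresponding to $X\in\mathrm{End}(F)$ under the adjunction $\mathrm{Hom}(FN,M)\cong\mathrm{Hom}(N,EM)$: if $\varphi\in\mathrm{Hom}(FN,M)$ corresponds to $\psi$, then $\varphi\circ X_N$ corresponds to $X_M\circ\psi$. Likewise $T\in\mathrm{End}(E^2)$ corresponds to $T\in\mathrm{End}(F^2)$ under $\mathrm{Hom}(F^2N,M)\cong\mathrm{Hom}(N,E^2M)$. (In terms of $\mathrm{GL}_n$ and the functor $V^*\otimes\bullet$, which is right adjoint to $V\otimes\bullet$ on all rational modules, the corresponding $X$ on $V^*\otimes M$ is the action of $-n-\sum_{i,j=1}^nE_{ij}\otimes E_{ji}$.) Data on $\mathbb{F}\mathfrak{S}\text{-mod}=\bigoplus_{d\ge0}\mathbb{F}\mathfrak{S}_d\text{-mod}$ (finite dimensional modules over symmetric groups). $E=\bigoplus_d\mathrm{Res}^d_{d-1}$ (restriction from $\mathfrak{S}_d$ to $\mathfrak{S}_{d-1}$, with $\mathrm{Res}^0_{-1}=0$). The endomorphism $X$ of $\mathrm{Res}^d_{d-1}$ is given by the action of the Jucys-Murphy element $\sum_{i=1}^{d-1}(i\,d)$, and the endomorphism $T$ of $E^2=\mathrm{Res}^{d}_{d-2}$ is given by the action of the transposition $(d-1\;d)$. Schur functor. On $\mathrm{Rep}^d(\mathrm{GL})=\mathrm{Rep}^d(\mathrm{GL}_n)$,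 $n\ge d$, $\mathcal{S}(M)=\mathrm{Hom}_{\mathrm{GL}_n}(V^{\otimes d},M)$, with $\mathfrak{S}_d$ acting via permutations of the tensor factors of $V^{\otimes d}$. Identification $E\mathcal{S}\cong\mathcal{S}E$. For $M\in\mathrm{Rep}^d(\mathrm{GL})$, it is the adjunction isomorphism $\mathcal{S}(EM)=\mathrm{Hom}(V^{\otimes d-1},EM)\cong\mathrm{Hom}(F(V^{\otimes d-1}),M)\cong\mathrm{Hom}(V^{\otimes d},M)=E\mathcal{S}(M)$, where $F(V^{\otimes d-1})=V\otimes V^{\otimes d-1}$ is identified with $V^{\otimes d}=V^{\otimes d-1}\otimes V$ by moving the first factor to the last place. In terms of $V^*\otimes\bullet$ this is the isomorphism sending $\varphi\in\mathrm{Hom}_{\mathrm{GL}_n}(V^{\otimes d},M)$ to the map $V^{\otimes d-1}\to V^*\otimes M$, $t\mapsto(\varphi\otimes\mathrm{id}_{V^*})(t\otimes\mathbf{1})$ (with the factors $M$ and $V^*$ then swapped), where $\mathbf{1}\in V\otimes V^*$ corresponds to the identity map. The identification $E^2\mathcal{S}\cong\mathcal{S}E^2$ is obtained by applying $E\mathcal{S}\cong\mathcal{S}E$ twice. *)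

theory Defs
  imports
    "HOL-Computational_Algebra.Polynomial"
    "Jordan_Normal_Form.Determinant"
    "HOL-Combinatorics.Transposition"
    "HOL-Algebra.Sym_Groups"
    "HOL-Algebra.Module"
begin

section \<open>Tensor products of coordinate spaces\<close>

text \<open>
  The basis vector \<open>e\<^sub>i \<otimes> f\<^sub>k\<close> of the tensor product of an \<open>n\<close>- and an \<open>m\<close>-dimensional coordinate
  space has index \<open>i * m + k\<close>.  With this convention tensor products are strictly associative.
\<close>

definition kron :: "'a::semiring_1 mat \<Rightarrow> 'a mat \<Rightarrow> 'a mat" where
  "kron A B = mat (dim_row A * dim_row B) (dim_col A * dim_col B)
     (\<lambda>(a, b). A $$ (a div dim_row B, b div dim_col B) * B $$ (a mod dim_row B, b mod dim_col B))"

definition matrix_unit :: "nat \<Rightarrow> nat \<Rightarrow> nat \<Rightarrow> 'a::semiring_1 mat" where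
  "matrix_unit n i j = mat n n (\<lambda>(a, b). if a = i \<and> b = j then 1 else 0)"

text \<open>
  Places in \<open>V\<^bsup>\<otimes>d\<^esup>\<close> are numbered \<open>1, \<dots>, d\<close> from the left, while basis vectors of \<open>V = F\<^sup>n\<close>
  are numbered \<open>0, \<dots>, n - 1\<close>.  The basis vector with index \<open>a < n ^ d\<close> has the basis vector number
  \<open>tensor_place n d a k\<close> of \<open>V\<close> in place \<open>k\<close>.
\<close>

definition tensor_place :: "nat \<Rightarrow> nat \<Rightarrow> nat \<Rightarrow> nat \<Rightarrow> nat" where
  "tensor_place n d a k = (a div n ^ (d - k)) mod n"

text \<open>
  The operator on \<open>V\<^bsup>\<otimes>d\<^esup>\<close> that moves the factor in place \<open>k\<close> to place \<open>\<sigma> k\<close>; for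
  permutations \<open>\<sigma>\<close> of \<open>{1..d}\<close> this is a left action.
\<close>

definition place_perm :: "nat \<Rightarrow> nat \<Rightarrow> (nat \<Rightarrow> nat) \<Rightarrow> 'a::semiring_1 mat" where
  "place_perm n d \<sigma> = mat (n ^ d) (n ^ d)
     (\<lambda>(a, b). if \<forall>k\<in>{1..d}. tensor_place n d a (\<sigma> k) = tensor_place n d b k then 1 else 0)"

section \<open>Rational representations of the general linear group\<close>

definition GL :: "nat \<Rightarrow> 'a::field mat set" where
  "GL n = {g \<in> carrier_mat n n. det g \<noteq> 0}"

text \<open>The coordinate ring of \<open>GL\<^sub>n\<close>, as a ring of functions.\<close>

inductive_set regular :: "nat \<Rightarrow> ('a::field mat \<Rightarrow> 'a) set" for n :: nat where
  const: "(\<lambda>g. c) \<in> regular n"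
| coord: "i < n \<Longrightarrow> j < n \<Longrightarrow> (\<lambda>g. g $$ (i, j)) \<in> regular n"
| inv_det: "(\<lambda>g. inverse (det g)) \<in> regular n"
| add: "f \<in> regular n \<Longrightarrow> h \<in> regular n \<Longrightarrow> (\<lambda>g. f g + h g) \<in> regular n"
| mult: "f \<in> regular n \<Longrightarrow> h \<in> regular n \<Longrightarrow> (\<lambda>g. f g * h g) \<in> regular n"

text \<open>
  Finite dimensional modules are given in coordinates: the module has underlying space
  \<open>F\<^bsup>rdim M\<^esup>\<close> and the group element \<open>g\<close> acts by the matrix \<open>ract M g\<close>.  The values of \<open>ract M\<close>
  off the group are irrelevant.
\<close>

record 'a gl_rep =
  rdim :: nat
  ract :: "'a mat \<Rightarrow> 'a mat"

definition rational_rep :: "nat \<Rightarrow> 'a::field gl_rep \<Rightarrow> bool" where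
  "rational_rep n M \<longleftrightarrow>
     (\<forall>g\<in>GL n. ract M g \<in> carrier_mat (rdim M) (rdim M)) \<and>
     ract M (1\<^sub>m n) = 1\<^sub>m (rdim M) \<and>
     (\<forall>g\<in>GL n. \<forall>h\<in>GL n. ract M (g * h) = ract M g * ract M h) \<and>
     (\<forall>a<rdim M. \<forall>b<rdim M. \<exists>f\<in>regular n. \<forall>g\<in>GL n. ract M g $$ (a, b) = f g)"

definition is_weight :: "nat \<Rightarrow> 'a::field gl_rep \<Rightarrow> (nat \<Rightarrow> int) \<Rightarrow> bool" where
  "is_weight n M \<mu> \<longleftrightarrow>
     (\<exists>v\<in>carrier_vec (rdim M). v \<noteq> 0\<^sub>v (rdim M) \<and>
        (\<forall>t. (\<forall>i<n. t i \<noteq> 0) \<longrightarrow>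
           ract M (mat_diag n t) *\<^sub>v v = (\<Prod>i<n. t i powi \<mu> i) \<cdot>\<^sub>v v))"

text \<open>The category \<open>Rep\<^sup>d(GL\<^sub>n)\<close>: objects \<open>Rep n d\<close>, morphisms \<open>gl_hom n M N\<close>.\<close>

definition Rep :: "nat \<Rightarrow> nat \<Rightarrow> 'a::field gl_rep set" where
  "Rep n d = {M. rational_rep n M \<and>
     (\<forall>\<mu>. is_weight n M \<mu> \<longrightarrow> (\<forall>i<n. 0 \<le> \<mu> i) \<and> (\<Sum>i<n. \<mu> i) = int d)}"

definition gl_hom :: "nat \<Rightarrow> 'a::field gl_rep \<Rightarrow> 'a gl_rep \<Rightarrow> 'a mat set" where
  "gl_hom n M N = {A \<in> carrier_mat (rdim N) (rdim M). \<forall>g\<in>GL n. A * ract M g = ract N g * A}"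

text \<open>
  The formal derivative at \<open>0\<close> of a rational function of one variable that is regular at \<open>0\<close>.
  It is well defined over an infinite field.
\<close>

definition rat_deriv0 :: "('a::field \<Rightarrow> 'a) \<Rightarrow> 'a" where
  "rat_deriv0 f = (THE D. \<exists>P Q. poly Q 0 \<noteq> 0 \<and>
     (\<forall>t. poly Q t \<noteq> 0 \<longrightarrow> f t = poly P t / poly Q t) \<and>
     D = (poly (pderiv P) 0 * poly Q 0 - poly P 0 * poly (pderiv Q) 0) / (poly Q 0)\<^sup>2)"

text \<open>
  The action of \<open>x \<in> gl\<^sub>n\<close> on a rational module: the differential at the identity of the
  representation, in the direction \<open>x\<close>.
\<close>

definition lie_act :: "nat \<Rightarrow> 'a::field gl_rep \<Rightarrow> 'a mat \<Rightarrow> 'a mat" where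
  "lie_act n M x = mat (rdim M) (rdim M) (\<lambda>p. rat_deriv0 (\<lambda>t. ract M (1\<^sub>m n + t \<cdot>\<^sub>m x) $$ p))"

section \<open>The functor \<open>F\<close> and its endomorphisms\<close>

definition F_obj :: "nat \<Rightarrow> 'a::field gl_rep \<Rightarrow> 'a gl_rep" where
  "F_obj n M = \<lparr>rdim = n * rdim M, ract = (\<lambda>g. kron g (ract M g))\<rparr>"

definition F_map :: "nat \<Rightarrow> 'a::field mat \<Rightarrow> 'a mat" where
  "F_map n f = kron (1\<^sub>m n) f"

definition X_F :: "nat \<Rightarrow> 'a::field gl_rep \<Rightarrow> 'a mat" where
  "X_F n M = mat (n * rdim M) (n * rdim M)
     (\<lambda>p. \<Sum>i<n. \<Sum>j<n. kron (matrix_unit n i j) (lie_act n M (matrix_unit n j i)) $$ p)"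

text \<open>On \<open>V \<otimes> V \<otimes> M\<close>, with \<open>V \<otimes> V\<close> carrying the place permutation \<open>(1 2)\<close>.\<close>

definition T_F :: "nat \<Rightarrow> 'a::field gl_rep \<Rightarrow> 'a mat" where
  "T_F n M = kron (place_perm n 2 (Transposition.transpose 1 2)) (1\<^sub>m (rdim M))"

text \<open>Since the factor is added on the left, \<open>F_obj n (tensor_power n d) = tensor_power n (Suc d)\<close>.\<close>

fun tensor_power :: "nat \<Rightarrow> nat \<Rightarrow> 'a::field gl_rep" where
  "tensor_power n 0 = \<lparr>rdim = 1, ract = (\<lambda>g. 1\<^sub>m 1)\<rparr>"
| "tensor_power n (Suc d) = F_obj n (tensor_power n d)"

section \<open>The functor \<open>E\<close> and its endomorphisms\<close>

text \<open>
  A candidate for the functor \<open>E\<close>, with its degree components \<open>Rep\<^bsup>d+1\<^esup> \<rightarrow> Rep\<^sup>d\<close> on objects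
  and on morphisms \<open>M \<rightarrow> M'\<close>, and the maps \<open>adj d N M : Hom(FN, M) \<rightarrow> Hom(N, EM)\<close> for
  \<open>N \<in> Rep\<^sup>d\<close> and \<open>M \<in> Rep\<^bsup>d+1\<^esup>\<close>.
\<close>

record 'a adjunction =
  E_obj :: "nat \<Rightarrow> 'a gl_rep \<Rightarrow> 'a gl_rep"
  E_map :: "nat \<Rightarrow> 'a gl_rep \<Rightarrow> 'a gl_rep \<Rightarrow> 'a mat \<Rightarrow> 'a mat"
  adj :: "nat \<Rightarrow> 'a gl_rep \<Rightarrow> 'a gl_rep \<Rightarrow> 'a mat \<Rightarrow> 'a mat"

text \<open>
  \<open>E\<close> is right adjoint to \<open>F\<close> by means of \<open>adj\<close>.  The categories \<open>Rep\<^sup>d(GL)\<close> with \<open>d \<le> n\<close> are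
  realised by \<open>GL\<^sub>n\<close>, so only the components between these degrees are constrained.  A right
  adjoint with its adjunction is unique up to unique isomorphism, so all choices are equivalent
  to the sum of the biadjoints of the eigenfunctors of \<open>X\<close> on \<open>F\<close>.
\<close>

definition right_adjoint_F :: "nat \<Rightarrow> 'a::field adjunction \<Rightarrow> bool" where
  "right_adjoint_F n A \<longleftrightarrow> (\<forall>d. Suc d \<le> n \<longrightarrow>
     \<comment> \<open>\<open>E\<close> is a functor:\<close>
     (\<forall>M\<in>Rep n (Suc d). E_obj A d M \<in> Rep n d) \<and>
     (\<forall>M\<in>Rep n (Suc d). \<forall>M'\<in>Rep n (Suc d). \<forall>f\<in>gl_hom n M M'.
        E_map A d M M' f \<in> gl_hom n (E_obj A d M) (E_obj A d M')) \<and>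
     (\<forall>M\<in>Rep n (Suc d). E_map A d M M (1\<^sub>m (rdim M)) = 1\<^sub>m (rdim (E_obj A d M))) \<and>
     (\<forall>M\<in>Rep n (Suc d). \<forall>M'\<in>Rep n (Suc d). \<forall>M''\<in>Rep n (Suc d).
        \<forall>f\<in>gl_hom n M M'. \<forall>h\<in>gl_hom n M' M''.
          E_map A d M M'' (h * f) = E_map A d M' M'' h * E_map A d M M' f) \<and>
     \<comment> \<open>\<open>adj\<close> is bijective and natural in both variables:\<close>
     (\<forall>N\<in>Rep n d. \<forall>M\<in>Rep n (Suc d).
        bij_betw (adj A d N M) (gl_hom n (F_obj n N) M) (gl_hom n N (E_obj A d M))) \<and>
     (\<forall>N\<in>Rep n d. \<forall>N'\<in>Rep n d. \<forall>M\<in>Rep n (Suc d).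
        \<forall>\<nu>\<in>gl_hom n N' N. \<forall>\<phi>\<in>gl_hom n (F_obj n N) M.
          adj A d N' M (\<phi> * F_map n \<nu>) = adj A d N M \<phi> * \<nu>) \<and>
     (\<forall>N\<in>Rep n d. \<forall>M\<in>Rep n (Suc d). \<forall>M'\<in>Rep n (Suc d).
        \<forall>f\<in>gl_hom n M M'. \<forall>\<phi>\<in>gl_hom n (F_obj n N) M.
          adj A d N M' (f * \<phi>) = E_map A d M M' f * adj A d N M \<phi>))"

text \<open>The component at \<open>M \<in> Rep\<^bsup>d+1\<^esup>\<close> of the endomorphism of \<open>E\<close> corresponding to \<open>X \<in> End(F)\<close>.\<close>

definition X_E :: "nat \<Rightarrow> 'a::field adjunction \<Rightarrow> nat \<Rightarrow> 'a gl_rep \<Rightarrow> 'a mat" where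
  "X_E n A d M = (THE \<chi>. \<chi> \<in> gl_hom n (E_obj A d M) (E_obj A d M) \<and>
     (\<forall>N\<in>Rep n d. \<forall>\<phi>\<in>gl_hom n (F_obj n N) M.
        adj A d N M (\<phi> * X_F n N) = \<chi> * adj A d N M \<phi>))"

text \<open>\<open>E\<^sup>2 : Rep\<^bsup>d+2\<^esup> \<rightarrow> Rep\<^sup>d\<close>, and \<open>Hom(F\<^sup>2N, M) \<cong> Hom(FN, EM) \<cong> Hom(N, E\<^sup>2M)\<close>.\<close>

definition E2_obj :: "'a::field adjunction \<Rightarrow> nat \<Rightarrow> 'a gl_rep \<Rightarrow> 'a gl_rep" where
  "E2_obj A d M = E_obj A d (E_obj A (Suc d) M)"

definition adj2 ::
  "nat \<Rightarrow> 'a::field adjunction \<Rightarrow> nat \<Rightarrow> 'a gl_rep \<Rightarrow> 'a gl_rep \<Rightarrow> 'a mat \<Rightarrow> 'a mat" where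
  "adj2 n A d N M \<phi> = adj A d N (E_obj A (Suc d) M) (adj A (Suc d) (F_obj n N) M \<phi>)"

definition T_E :: "nat \<Rightarrow> 'a::field adjunction \<Rightarrow> nat \<Rightarrow> 'a gl_rep \<Rightarrow> 'a mat" where
  "T_E n A d M = (THE \<chi>. \<chi> \<in> gl_hom n (E2_obj A d M) (E2_obj A d M) \<and>
     (\<forall>N\<in>Rep n d. \<forall>\<phi>\<in>gl_hom n (F_obj n (F_obj n N)) M.
        adj2 n A d N M (\<phi> * T_F n N) = \<chi> * adj2 n A d N M \<phi>))"

section \<open>Modules over symmetric groups\<close>

text \<open>
  A module over the symmetric group on \<open>{1..d}\<close>: a vector space together with the action
  \<open>sact N \<sigma>\<close> of the elements \<open>\<sigma>\<close> of \<open>sym_group d\<close>.  Restriction to \<open>sym_group (d - 1)\<close>, the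
  permutations fixing \<open>d\<close>, does not change these data.
\<close>

record ('a, 'v) sym_module = "('a, 'v) module" +
  sact :: "(nat \<Rightarrow> nat) \<Rightarrow> 'v \<Rightarrow> 'v"

text \<open>\<open>X\<close> on \<open>E N\<close> and \<open>T\<close> on \<open>E\<^sup>2 N\<close>, for a module \<open>N\<close> over the symmetric group on \<open>{1..d}\<close>.\<close>

definition X_Res :: "nat \<Rightarrow> ('a, 'v) sym_module \<Rightarrow> 'v \<Rightarrow> 'v" where
  "X_Res d N v = (\<Oplus>\<^bsub>N\<^esub>i\<in>{1..d - 1}. sact N (Transposition.transpose i d) v)"

definition T_Res :: "nat \<Rightarrow> ('a, 'v) sym_module \<Rightarrow> 'v \<Rightarrow> 'v" where
  "T_Res d N v = sact N (Transposition.transpose (d - 1) d) v"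

section \<open>The Schur functor\<close>

text \<open>
  \<open>Hom(V\<^bsup>\<otimes>d\<^esup>, M)\<close>.  The left action on \<open>V\<^bsup>\<otimes>d\<^esup>\<close> is turned into a left action on the Hom-space
  by means of inverses.  The fields \<open>mult\<close> and \<open>one\<close> have no meaning for a module.
\<close>

definition schur_obj :: "nat \<Rightarrow> nat \<Rightarrow> 'a::field gl_rep \<Rightarrow> ('a, 'a mat) sym_module" where
  "schur_obj n d M =
     \<lparr>carrier = gl_hom n (tensor_power n d) M, mult = (*), one = 1\<^sub>m (rdim M),
      zero = 0\<^sub>m (rdim M) (n ^ d), add = (+), module.smult = (\<cdot>\<^sub>m),
      sact = (\<lambda>\<sigma> \<phi>. \<phi> * place_perm n d (Hilbert_Choice.inv \<sigma>))\<rparr>"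

definition schur_map :: "'a::field mat \<Rightarrow> 'a mat \<Rightarrow> 'a mat" where
  "schur_map f \<phi> = f * \<phi>"

definition last_to_first :: "nat \<Rightarrow> nat \<Rightarrow> nat" where
  "last_to_first d k = (if k = d then 1 else if 1 \<le> k \<and> k < d then k + 1 else k)"

text \<open>
  The isomorphism \<open>S(EM) = Hom(V\<^bsup>\<otimes>d\<^esup>, EM) \<cong> Hom(F(V\<^bsup>\<otimes>d\<^esup>), M) \<cong> Hom(V\<^bsup>\<otimes>d+1\<^esup>, M) = E S(M)\<close> for
  \<open>M \<in> Rep\<^bsup>d+1\<^esup>\<close>.  As \<open>F(V\<^bsup>\<otimes>d\<^esup>) \<cong> V\<^bsup>\<otimes>d+1\<^esup>\<close> moves the first factor to the last place, a map out of
  \<open>F(V\<^bsup>\<otimes>d\<^esup>)\<close> is transported to one out of \<open>V\<^bsup>\<otimes>d+1\<^esup>\<close> by precomposing with the inverse.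
\<close>

definition schur_E_iso ::
  "nat \<Rightarrow> 'a::field adjunction \<Rightarrow> nat \<Rightarrow> 'a gl_rep \<Rightarrow> 'a mat \<Rightarrow> 'a mat" where
  "schur_E_iso n A d M \<psi> =
     inv_into (gl_hom n (F_obj n (tensor_power n d)) M) (adj A d (tensor_power n d) M) \<psi>
       * place_perm n (Suc d) (last_to_first (Suc d))"

text \<open>\<open>S(E\<^sup>2M) \<cong> E S(EM) \<cong> E\<^sup>2 S(M)\<close> for \<open>M \<in> Rep\<^bsup>d+2\<^esup>\<close>.\<close>

definition schur_E2_iso ::
  "nat \<Rightarrow> 'a::field adjunction \<Rightarrow> nat \<Rightarrow> 'a gl_rep \<Rightarrow> 'a mat \<Rightarrow> 'a mat" where
  "schur_E2_iso n A d M \<psi> =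
     schur_E_iso n A (Suc d) M (schur_E_iso n A d (E_obj A (Suc d) M) \<psi>)"

end

theory Submission
  imports Defs
begin

text \<open>
  The operators \<open>X\<close> and \<open>T\<close> on \<open>E\<close> are the transports of \<open>X\<close> and \<open>T\<close> on \<open>F\<close> along the adjunction.
  If \<open>\<psi> : V\<^bsup>\<otimes>d\<^esup> \<rightarrow> EM\<close> corresponds to \<open>\<phi> : V \<otimes> V\<^bsup>\<otimes>d\<^esup> \<rightarrow> M\<close>, then \<open>X \<psi>\<close> corresponds to \<open>\<phi> X\<close>, so only
  the operator \<open>X\<close> on \<open>V \<otimes> V\<^bsup>\<otimes>d\<^esup>\<close> has to be known. The tensor \<open>\<Sum> E\<^sub>i\<^sub>j \<otimes> E\<^sub>j\<^sub>i\<close> acts on \<open>V \<otimes> V\<close> by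
  exchanging the factors, and \<open>gl\<^sub>n\<close> acts on \<open>V\<^bsup>\<otimes>d\<^esup>\<close> by the Leibniz rule; hence this operator is the
  sum of the transpositions \<open>(1 k+1)\<close> of places, for \<open>k = 1, \<dots>, d\<close> (\<open>X_F_tensor_power\<close>). The
  identification of \<open>ES\<close> with \<open>SE\<close> moves the last place to the front and thus conjugates \<open>(1 k+1)\<close>
  into \<open>(k d+1)\<close>, and the sum into the Jucys-Murphy element (\<open>schur_E_iso_X\<close>). For \<open>T\<close> the operator
  on \<open>V \<otimes> V \<otimes> V\<^bsup>\<otimes>d\<^esup>\<close> is \<open>(1 2)\<close>, and the two last places are moved to the places \<open>2\<close> and \<open>1\<close>, so
  that \<open>(1 2)\<close> becomes \<open>(d+1 d+2)\<close> (\<open>schur_E2_iso_T\<close>).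

  The operators on \<open>E\<close> are given by definite descriptions, which say nothing unless the described
  endomorphism exists and is unique. This is the Yoneda lemma (\<open>yoneda_endomorphism\<close>). It needs \<open>X\<close>
  and \<open>T\<close> on \<open>F\<close> to be natural and equivariant on all polynomial representations, and not only on
  tensor powers, because it is applied to the counit, whose source is \<open>FEM\<close> or \<open>F\<^sup>2E\<^sup>2M\<close>. For \<open>T\<close>
  both are immediate. For \<open>X\<close> they rest on two properties of the action of \<open>gl\<^sub>n\<close> on a rational
  module: it is linear (\<open>lie_act_linear\<close>), and it respects intertwining relations, in particular
  conjugation by group elements (\<open>lie_act_intertwine\<close>). Both follow from the differential calculus
  of rational functions of one variable, since the matrix entries of a rational module are rational
  functions on the group.
\<close>

section \<open>Derivatives of rational functions at \<open>0\<close>\<close>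

lemma alg_closed_field_infinite: "infinite (UNIV :: 'a::alg_closed_field set)"
proof
  assume fin: "finite (UNIV :: 'a set)"
  define p :: "'a poly" where "p = (\<Prod>c\<in>UNIV. [:- c, 1:])"
  have deg: "degree p = card (UNIV :: 'a set)"
    unfolding p_def by (subst degree_prod_eq_sum_degree) auto
  have "card (UNIV :: 'a set) > 0"
    using fin by (simp add: card_gt_0_iff)
  \<comment> \<open>The product of all \<open>X - c\<close>, shifted by \<open>1\<close>, would have no root.\<close>
  then have "degree (p + 1) > 0"
    using deg by (simp add: degree_add_eq_left)
  then obtain x where "poly (p + 1) x = 0"
    using alg_closed_imp_poly_has_root by blast
  moreover have "poly p x = 0"
    using fin by (simp add: p_def poly_prod)
  ultimately show False
    by simp
qed

text \<open>
  The relation inside the description that defines \<^const>\<open>rat_deriv0\<close>; the rules of calculus are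
  proved for it, because they need no choice of a representing fraction.
\<close>

definition has_rat_deriv0 :: "('a::field \<Rightarrow> 'a) \<Rightarrow> 'a \<Rightarrow> bool" where
  "has_rat_deriv0 f D \<longleftrightarrow> (\<exists>P Q. poly Q 0 \<noteq> 0 \<and>
     (\<forall>t. poly Q t \<noteq> 0 \<longrightarrow> f t = poly P t / poly Q t) \<and>
     D = (poly (pderiv P) 0 * poly Q 0 - poly P 0 * poly (pderiv Q) 0) / (poly Q 0)\<^sup>2)"

lemma has_rat_deriv0I:
  assumes "poly Q 0 \<noteq> 0" "\<And>t. poly Q t \<noteq> 0 \<Longrightarrow> f t = poly P t / poly Q t"
    and "D = (poly (pderiv P) 0 * poly Q 0 - poly P 0 * poly (pderiv Q) 0) / (poly Q 0)\<^sup>2"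
  shows "has_rat_deriv0 f D"
  using assms unfolding has_rat_deriv0_def by blast

text \<open>
  Two fractions that represent the same function agree off the zeros of their denominators, so they
  are equal as fractions because the field is infinite. The quotient rule depends only on the
  fraction.
\<close>

lemma has_rat_deriv0_unique:
  fixes f :: "'a::alg_closed_field \<Rightarrow> 'a"
  assumes "has_rat_deriv0 f D" "has_rat_deriv0 f D'"
  shows "D = D'"
proof -
  obtain P Q where q: "poly Q 0 \<noteq> 0" and PQ: "\<And>t. poly Q t \<noteq> 0 \<Longrightarrow> f t = poly P t / poly Q t"
    and D: "D = (poly (pderiv P) 0 * poly Q 0 - poly P 0 * poly (pderiv Q) 0) / (poly Q 0)\<^sup>2"
    using assms(1) unfolding has_rat_deriv0_def by blast
  obtain P' Q' where q': "poly Q' 0 \<noteq> 0"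
    and PQ': "\<And>t. poly Q' t \<noteq> 0 \<Longrightarrow> f t = poly P' t / poly Q' t"
    and D': "D' = (poly (pderiv P') 0 * poly Q' 0 - poly P' 0 * poly (pderiv Q') 0) / (poly Q' 0)\<^sup>2"
    using assms(2) unfolding has_rat_deriv0_def by blast
  \<comment> \<open>The factor \<open>Q * Q'\<close> makes \<open>R\<close> vanish where a denominator does.\<close>
  define R where "R = (P * Q' - P' * Q) * (Q * Q')"
  have "poly R t = 0" for t
  proof (cases "poly Q t = 0 \<or> poly Q' t = 0")
    case False
    then have "poly P t / poly Q t = poly P' t / poly Q' t"
      using PQ PQ' by metis
    then show ?thesis
      using False by (simp add: R_def frac_eq_eq)
  qed (auto simp: R_def)
  then have "R = 0"
    using poly_roots_finite[of R] alg_closed_field_infinite by fastforce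
  moreover have "Q \<noteq> 0" "Q' \<noteq> 0"
    using q q' by auto
  ultimately have eq: "P * Q' = P' * Q"
    by (simp add: R_def)
  have e0: "poly P 0 * poly Q' 0 = poly P' 0 * poly Q 0"
    using arg_cong[OF eq, of "\<lambda>p. poly p 0"] by simp
  have e1: "poly P 0 * poly (pderiv Q') 0 + poly Q' 0 * poly (pderiv P) 0 =
      poly P' 0 * poly (pderiv Q) 0 + poly Q 0 * poly (pderiv P') 0"
    using arg_cong[OF eq, of "\<lambda>p. poly (pderiv p) 0"] by (simp add: pderiv_mult)
  have "(p1 * q - p * q1) * q'\<^sup>2 = (p1' * q' - p' * q1') * q\<^sup>2"
    if "p * q' = p' * q" "p * q1' + q' * p1 = p' * q1 + q * p1'" for p q p1 q1 p' q' p1' q1' :: 'a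
  proof -
    have "(p1 * q - p * q1) * q'\<^sup>2 = q * q' * (q' * p1) - p * q' * q1 * q'"
      by (simp add: algebra_simps power2_eq_square)
    also have "\<dots> = q * q' * (p' * q1 + q * p1' - p * q1') - p' * q * q1 * q'"
      using that by (simp add: eq_diff_eq add.commute)
    also have "\<dots> = q\<^sup>2 * q' * p1' - p * q' * q * q1'"
      by (simp add: algebra_simps power2_eq_square)
    also have "\<dots> = (p1' * q' - p' * q1') * q\<^sup>2"
      using that by (simp add: algebra_simps power2_eq_square)
    finally show ?thesis .
  qed
  from this[OF e0 e1] show ?thesis
    unfolding D D' using q q' by (simp add: frac_eq_eq)
qed

lemma rat_deriv0_eqI:
  fixes f :: "'a::alg_closed_field \<Rightarrow> 'a"
  assumes "has_rat_deriv0 f D"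
  shows "rat_deriv0 f = D"
proof -
  have "rat_deriv0 f = (THE D. has_rat_deriv0 f D)"
    unfolding rat_deriv0_def has_rat_deriv0_def ..
  then show ?thesis
    using assms has_rat_deriv0_unique by (metis the_equality)
qed

lemma has_rat_deriv0_const: "has_rat_deriv0 (\<lambda>t. c) 0"
  by (rule has_rat_deriv0I[where P = "[:c:]" and Q = 1]) auto

lemma has_rat_deriv0_linear: "has_rat_deriv0 (\<lambda>t. a + t * b) b"
  by (rule has_rat_deriv0I[where P = "[:a, b:]" and Q = 1]) (auto simp: pderiv_pCons)

lemma has_rat_deriv0_add:
  assumes "has_rat_deriv0 f D" "has_rat_deriv0 g E"
  shows "has_rat_deriv0 (\<lambda>t. f t + g t) (D + E)"
proof -
  obtain P Q where f: "poly Q 0 \<noteq> 0" "\<And>t. poly Q t \<noteq> 0 \<Longrightarrow> f t = poly P t / poly Q t"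
    "D = (poly (pderiv P) 0 * poly Q 0 - poly P 0 * poly (pderiv Q) 0) / (poly Q 0)\<^sup>2"
    using assms(1) unfolding has_rat_deriv0_def by blast
  obtain R S where g: "poly S 0 \<noteq> 0" "\<And>t. poly S t \<noteq> 0 \<Longrightarrow> g t = poly R t / poly S t"
    "E = (poly (pderiv R) 0 * poly S 0 - poly R 0 * poly (pderiv S) 0) / (poly S 0)\<^sup>2"
    using assms(2) unfolding has_rat_deriv0_def by blast
  show ?thesis
    by (rule has_rat_deriv0I[where P = "P * S + R * Q" and Q = "Q * S"])
      (use f(1) g(1) in \<open>auto simp: f(2,3) g(2,3) pderiv_mult pderiv_add field_simps power2_eq_square\<close>)
qed

lemma has_rat_deriv0_mult:
  assumes "has_rat_deriv0 f D" "has_rat_deriv0 g E"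
  shows "has_rat_deriv0 (\<lambda>t. f t * g t) (D * g 0 + f 0 * E)"
proof -
  obtain P Q where f: "poly Q 0 \<noteq> 0" "\<And>t. poly Q t \<noteq> 0 \<Longrightarrow> f t = poly P t / poly Q t"
    "D = (poly (pderiv P) 0 * poly Q 0 - poly P 0 * poly (pderiv Q) 0) / (poly Q 0)\<^sup>2"
    using assms(1) unfolding has_rat_deriv0_def by blast
  obtain R S where g: "poly S 0 \<noteq> 0" "\<And>t. poly S t \<noteq> 0 \<Longrightarrow> g t = poly R t / poly S t"
    "E = (poly (pderiv R) 0 * poly S 0 - poly R 0 * poly (pderiv S) 0) / (poly S 0)\<^sup>2"
    using assms(2) unfolding has_rat_deriv0_def by blast
  show ?thesis
    by (rule has_rat_deriv0I[where P = "P * R" and Q = "Q * S"])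
      (use f(1) g(1) in \<open>auto simp: f(2,3) g(2,3) pderiv_mult field_simps power2_eq_square\<close>)
qed

lemma has_rat_deriv0_inverse:
  assumes "has_rat_deriv0 f D" "f 0 \<noteq> 0"
  shows "has_rat_deriv0 (\<lambda>t. inverse (f t)) (- D / (f 0)\<^sup>2)"
proof -
  obtain P Q where f: "poly Q 0 \<noteq> 0" "\<And>t. poly Q t \<noteq> 0 \<Longrightarrow> f t = poly P t / poly Q t"
    "D = (poly (pderiv P) 0 * poly Q 0 - poly P 0 * poly (pderiv Q) 0) / (poly Q 0)\<^sup>2"
    using assms(1) unfolding has_rat_deriv0_def by blast
  have p: "poly P 0 \<noteq> 0"
    using assms(2) f(1,2) by auto
  show ?thesis
    by (rule has_rat_deriv0I[where P = "Q * Q" and Q = "P * Q"])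
      (use f(1) p in \<open>auto simp: f(2,3) pderiv_mult field_simps power2_eq_square\<close>)
qed

text \<open>
  Multiplying numerator and denominator by \<open>R\<close> discards the parameters with \<open>poly R t = 0\<close>. This is
  how the restriction to the group, where \<open>1 + t x\<close> is invertible, is absorbed.
\<close>

lemma has_rat_deriv0_cong:
  assumes "has_rat_deriv0 f D" "poly R 0 \<noteq> 0" "\<And>t. poly R t \<noteq> 0 \<Longrightarrow> f t = g t"
  shows "has_rat_deriv0 g D"
proof -
  obtain P Q where f: "poly Q 0 \<noteq> 0" "\<And>t. poly Q t \<noteq> 0 \<Longrightarrow> f t = poly P t / poly Q t"
    "D = (poly (pderiv P) 0 * poly Q 0 - poly P 0 * poly (pderiv Q) 0) / (poly Q 0)\<^sup>2"
    using assms(1) unfolding has_rat_deriv0_def by blast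
  show ?thesis
    by (rule has_rat_deriv0I[where P = "P * R" and Q = "Q * R"])
      (use f(1) assms(2) in \<open>auto simp: f(2,3) assms(3)[symmetric] pderiv_mult field_simps power2_eq_square\<close>)
qed

lemma has_rat_deriv0_sum:
  assumes "finite I" "\<And>i. i \<in> I \<Longrightarrow> has_rat_deriv0 (f i) (D i)"
  shows "has_rat_deriv0 (\<lambda>t. \<Sum>i\<in>I. f i t) (\<Sum>i\<in>I. D i)"
  using assms by (induction I rule: finite_induct)
    (auto intro: has_rat_deriv0_const has_rat_deriv0_add)

lemma has_rat_deriv0_prod_linear:
  "has_rat_deriv0 (\<lambda>t. \<Prod>i\<in>I. a i + t * b i) (\<Sum>i\<in>I. b i * (\<Prod>j\<in>I - {i}. a j))"
  by (rule has_rat_deriv0I[where P = "\<Prod>i\<in>I. [:a i, b i:]" and Q = 1])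
    (auto simp: poly_prod poly_sum pderiv_prod pderiv_pCons mult.commute)

section \<open>The differential of a rational representation\<close>

text \<open>
  Differentiability at the identity, with a differential that is linear in the direction: the
  coefficient \<open>c r s\<close> is the partial derivative in the direction of a matrix unit. The direction has
  to be inside the scope of \<open>c\<close>, since linearity in \<open>x\<close> is what the definition of \<open>lie_act\<close> by
  separate one-variable derivatives does not provide.
\<close>

definition regular_at_one :: "nat \<Rightarrow> ('a::field mat \<Rightarrow> 'a) \<Rightarrow> bool" where
  "regular_at_one n f \<longleftrightarrow> (\<exists>c. \<forall>x\<in>carrier_mat n n.
     has_rat_deriv0 (\<lambda>t. f (1\<^sub>m n + t \<cdot>\<^sub>m x)) (\<Sum>r<n. \<Sum>s<n. c r s * x $$ (r, s)))"

lemma regular_at_one_const: "regular_at_one n (\<lambda>g. c)"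
  unfolding regular_at_one_def
  by (intro exI[of _ "\<lambda>_ _. 0"]) (auto intro: has_rat_deriv0_const)

lemma regular_at_one_coord:
  assumes "i < n" "j < n"
  shows "regular_at_one n (\<lambda>g. g $$ (i, j))"
  unfolding regular_at_one_def
proof (intro exI[of _ "\<lambda>r s. if s = j then if r = i then 1 else 0 else 0"] ballI)
  fix x :: "'a mat" assume x: "x \<in> carrier_mat n n"
  have "(\<Sum>r<n. \<Sum>s<n. (if s = j then if r = i then 1 else 0 else 0) * x $$ (r, s)) = x $$ (i, j)"
    using assms by (simp add: if_distrib[of "\<lambda>c. c * _"] cong: if_cong)
  moreover have "(1\<^sub>m n + t \<cdot>\<^sub>m x) $$ (i, j) = 1\<^sub>m n $$ (i, j) + t * x $$ (i, j)" for t
    using x assms by simp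
  ultimately show "has_rat_deriv0 (\<lambda>t. (1\<^sub>m n + t \<cdot>\<^sub>m x) $$ (i, j))
      (\<Sum>r<n. \<Sum>s<n. (if s = j then if r = i then 1 else 0 else 0) * x $$ (r, s))"
    using has_rat_deriv0_linear[of "1\<^sub>m n $$ (i, j)" "x $$ (i, j)"] by simp
qed

lemma regular_at_one_add:
  assumes "regular_at_one n f" "regular_at_one n h"
  shows "regular_at_one n (\<lambda>g. f g + h g)"
proof -
  obtain c d where "\<forall>x\<in>carrier_mat n n.
     has_rat_deriv0 (\<lambda>t. f (1\<^sub>m n + t \<cdot>\<^sub>m x)) (\<Sum>r<n. \<Sum>s<n. c r s * x $$ (r, s))"
    "\<forall>x\<in>carrier_mat n n.
     has_rat_deriv0 (\<lambda>t. h (1\<^sub>m n + t \<cdot>\<^sub>m x)) (\<Sum>r<n. \<Sum>s<n. d r s * x $$ (r, s))"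
    using assms unfolding regular_at_one_def by blast
  then show ?thesis
    unfolding regular_at_one_def
    by (intro exI[of _ "\<lambda>r s. c r s + d r s"])
      (auto simp: distrib_right sum.distrib intro: has_rat_deriv0_add)
qed

lemma one_plus_zero_smult:
  "x \<in> carrier_mat n n \<Longrightarrow> 1\<^sub>m n + 0 \<cdot>\<^sub>m x = (1\<^sub>m n :: 'a::field mat)"
  by (intro eq_matI) auto

lemma regular_at_one_mult:
  assumes "regular_at_one n f" "regular_at_one n h"
  shows "regular_at_one n (\<lambda>g. f g * h g)"
proof -
  obtain c d where c: "\<forall>x\<in>carrier_mat n n.
     has_rat_deriv0 (\<lambda>t. f (1\<^sub>m n + t \<cdot>\<^sub>m x)) (\<Sum>r<n. \<Sum>s<n. c r s * x $$ (r, s))"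
    and d: "\<forall>x\<in>carrier_mat n n.
     has_rat_deriv0 (\<lambda>t. h (1\<^sub>m n + t \<cdot>\<^sub>m x)) (\<Sum>r<n. \<Sum>s<n. d r s * x $$ (r, s))"
    using assms unfolding regular_at_one_def by blast
  show ?thesis
    unfolding regular_at_one_def
  proof (intro exI[of _ "\<lambda>r s. c r s * h (1\<^sub>m n) + f (1\<^sub>m n) * d r s"] ballI)
    fix x :: "'a mat" assume x: "x \<in> carrier_mat n n"
    have "(\<Sum>r<n. \<Sum>s<n. (c r s * h (1\<^sub>m n) + f (1\<^sub>m n) * d r s) * x $$ (r, s)) =
      (\<Sum>r<n. \<Sum>s<n. c r s * x $$ (r, s)) * h (1\<^sub>m n + 0 \<cdot>\<^sub>m x) +
      f (1\<^sub>m n + 0 \<cdot>\<^sub>m x) * (\<Sum>r<n. \<Sum>s<n. d r s * x $$ (r, s))"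
      by (simp add: one_plus_zero_smult[OF x] sum_distrib_left sum_distrib_right
          sum.distrib[symmetric] algebra_simps)
    then show "has_rat_deriv0 (\<lambda>t. f (1\<^sub>m n + t \<cdot>\<^sub>m x) * h (1\<^sub>m n + t \<cdot>\<^sub>m x))
      (\<Sum>r<n. \<Sum>s<n. (c r s * h (1\<^sub>m n) + f (1\<^sub>m n) * d r s) * x $$ (r, s))"
      using has_rat_deriv0_mult[OF c[rule_format, OF x] d[rule_format, OF x]] by simp
  qed
qed

lemma regular_at_one_inverse:
  assumes "regular_at_one n f" "f (1\<^sub>m n) \<noteq> 0"
  shows "regular_at_one n (\<lambda>g. inverse (f g))"
proof -
  obtain c where c: "\<forall>x\<in>carrier_mat n n.
     has_rat_deriv0 (\<lambda>t. f (1\<^sub>m n + t \<cdot>\<^sub>m x)) (\<Sum>r<n. \<Sum>s<n. c r s * x $$ (r, s))"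
    using assms unfolding regular_at_one_def by blast
  show ?thesis
    unfolding regular_at_one_def
  proof (intro exI[of _ "\<lambda>r s. - c r s / (f (1\<^sub>m n))\<^sup>2"] ballI)
    fix x :: "'a mat" assume x: "x \<in> carrier_mat n n"
    show "has_rat_deriv0 (\<lambda>t. inverse (f (1\<^sub>m n + t \<cdot>\<^sub>m x)))
        (\<Sum>r<n. \<Sum>s<n. - c r s / (f (1\<^sub>m n))\<^sup>2 * x $$ (r, s))"
      using has_rat_deriv0_inverse[OF c[rule_format, OF x]] assms(2)
      by (simp add: one_plus_zero_smult[OF x] sum_divide_distrib sum_negf)
  qed
qed

lemma regular_at_one_sum:
  assumes "\<And>i. i \<in> I \<Longrightarrow> regular_at_one n (f i)"
  shows "regular_at_one n (\<lambda>g. \<Sum>i\<in>I. f i g)"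
  using assms by (induction I rule: infinite_finite_induct)
    (auto intro: regular_at_one_const regular_at_one_add)

lemma regular_at_one_prod:
  assumes "\<And>i. i \<in> I \<Longrightarrow> regular_at_one n (f i)"
  shows "regular_at_one n (\<lambda>g. \<Prod>i\<in>I. f i g)"
  using assms by (induction I rule: infinite_finite_induct)
    (auto intro: regular_at_one_const regular_at_one_mult)

lemma regular_at_one_cong:
  assumes "regular_at_one n f" "\<And>g. g \<in> carrier_mat n n \<Longrightarrow> f g = h g"
  shows "regular_at_one n h"
  using assms unfolding regular_at_one_def by simp

text \<open>
  The Leibniz formula makes the determinant a polynomial in the coordinates.
\<close>

lemma regular_at_one_det: "regular_at_one n (det :: 'a::field mat \<Rightarrow> 'a)"
proof (rule regular_at_one_cong)
  show "regular_at_one n (\<lambda>g :: 'a mat. \<Sum>p\<in>{p. p permutes {0..<n}}.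
      signof p * (\<Prod>i = 0..<n. g $$ (i, p i)))"
    by (intro regular_at_one_sum regular_at_one_mult regular_at_one_const regular_at_one_prod
        regular_at_one_coord) (auto simp: permutes_in_image dest: permutes_in_image)
qed (simp add: det_def')

lemma regular_imp_regular_at_one: "f \<in> regular n \<Longrightarrow> regular_at_one n f"
  by (induction rule: regular.induct)
    (auto intro: regular_at_one_const regular_at_one_coord regular_at_one_add
      regular_at_one_mult regular_at_one_inverse regular_at_one_det)

text \<open>
  The determinant of \<open>1 + t x\<close> is a nonzero function of \<open>t\<close>, being \<open>1\<close> at \<open>t = 0\<close>, so a
  polynomial \<open>R\<close> can be chosen to vanish wherever it does.
\<close>

lemma generic_one_plus_in_GL:
  fixes x :: "'a::field mat"
  assumes x: "x \<in> carrier_mat n n"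
  obtains R where "poly R 0 \<noteq> 0" "\<And>t. poly R t \<noteq> 0 \<Longrightarrow> 1\<^sub>m n + t \<cdot>\<^sub>m x \<in> GL n"
proof -
  obtain D where "has_rat_deriv0 (\<lambda>t. det (1\<^sub>m n + t \<cdot>\<^sub>m x)) D"
    using regular_at_one_det x unfolding regular_at_one_def by blast
  then obtain P Q where q: "poly Q 0 \<noteq> 0"
    and PQ: "\<And>t. poly Q t \<noteq> 0 \<Longrightarrow> det (1\<^sub>m n + t \<cdot>\<^sub>m x) = poly P t / poly Q t"
    unfolding has_rat_deriv0_def by blast
  have "poly P 0 \<noteq> 0"
    using PQ[OF q] one_plus_zero_smult[OF x] by auto
  then show thesis
    using that[of "P * Q"] q PQ x by (auto simp: GL_def)
qed

lemma lie_act_carrier [simp]: "lie_act n M x \<in> carrier_mat (rdim M) (rdim M)"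
  by (simp add: lie_act_def)

lemma matrix_unit_carrier [simp]: "matrix_unit n i j \<in> carrier_mat n n"
  by (simp add: matrix_unit_def)

text \<open>
  The choice of \<open>c\<close> before the direction \<open>x\<close> expresses that the differential of a representation is
  linear.
\<close>

lemma rational_rep_deriv:
  fixes M :: "'a::alg_closed_field gl_rep"
  assumes "rational_rep n M" "a < rdim M" "b < rdim M"
  shows "\<exists>c. \<forall>x\<in>carrier_mat n n.
    has_rat_deriv0 (\<lambda>t. ract M (1\<^sub>m n + t \<cdot>\<^sub>m x) $$ (a, b)) (\<Sum>r<n. \<Sum>s<n. c r s * x $$ (r, s))"
proof -
  obtain f where f: "f \<in> regular n" "\<And>g. g \<in> GL n \<Longrightarrow> ract M g $$ (a, b) = f g"
    using assms unfolding rational_rep_def by blast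
  obtain c where c: "\<And>x. x \<in> carrier_mat n n \<Longrightarrow>
    has_rat_deriv0 (\<lambda>t. f (1\<^sub>m n + t \<cdot>\<^sub>m x)) (\<Sum>r<n. \<Sum>s<n. c r s * x $$ (r, s))"
    using regular_imp_regular_at_one[OF f(1)] unfolding regular_at_one_def by blast
  show ?thesis
  proof (intro exI[of _ c] ballI)
    fix x :: "'a mat" assume x: "x \<in> carrier_mat n n"
    obtain R where "poly R 0 \<noteq> 0" "\<And>t. poly R t \<noteq> 0 \<Longrightarrow> 1\<^sub>m n + t \<cdot>\<^sub>m x \<in> GL n"
      using generic_one_plus_in_GL[OF x] by blast
    then show "has_rat_deriv0 (\<lambda>t. ract M (1\<^sub>m n + t \<cdot>\<^sub>m x) $$ (a, b))
        (\<Sum>r<n. \<Sum>s<n. c r s * x $$ (r, s))"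
      using has_rat_deriv0_cong[OF c[OF x]] f(2) by simp
  qed
qed

lemma lie_act_has_rat_deriv0:
  fixes M :: "'a::alg_closed_field gl_rep"
  assumes "rational_rep n M" "a < rdim M" "b < rdim M" "x \<in> carrier_mat n n"
  shows "has_rat_deriv0 (\<lambda>t. ract M (1\<^sub>m n + t \<cdot>\<^sub>m x) $$ (a, b)) (lie_act n M x $$ (a, b))"
proof -
  obtain D where D: "has_rat_deriv0 (\<lambda>t. ract M (1\<^sub>m n + t \<cdot>\<^sub>m x) $$ (a, b)) D"
    using rational_rep_deriv[OF assms(1-3)] assms(4) by blast
  then show ?thesis
    using rat_deriv0_eqI[OF D] assms(2,3) by (simp add: lie_act_def)
qed

lemma sum_matrix_unit:
  assumes "i < n" "j < n"
  shows "(\<Sum>r<n. \<Sum>s<n. c r s * matrix_unit n i j $$ (r, s)) = (c i j :: 'a::semiring_1)"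
proof -
  have "(\<Sum>r<n. \<Sum>s<n. c r s * matrix_unit n i j $$ (r, s)) =
      (\<Sum>r<n. \<Sum>s<n. if s = j then if r = i then c r s else 0 else 0)"
    by (intro sum.cong refl) (auto simp: matrix_unit_def)
  also have "\<dots> = c i j"
    using assms by simp
  finally show ?thesis .
qed

lemma lie_act_linear:
  fixes M :: "'a::alg_closed_field gl_rep"
  assumes M: "rational_rep n M" and ab: "a < rdim M" "b < rdim M" and x: "x \<in> carrier_mat n n"
  shows "lie_act n M x $$ (a, b) =
    (\<Sum>r<n. \<Sum>s<n. lie_act n M (matrix_unit n r s) $$ (a, b) * x $$ (r, s))"
proof -
  obtain c where c: "\<And>x. x \<in> carrier_mat n n \<Longrightarrow>
    has_rat_deriv0 (\<lambda>t. ract M (1\<^sub>m n + t \<cdot>\<^sub>m x) $$ (a, b)) (\<Sum>r<n. \<Sum>s<n. c r s * x $$ (r, s))"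
    using rational_rep_deriv[OF M ab] by blast
  have L: "lie_act n M y $$ (a, b) = (\<Sum>r<n. \<Sum>s<n. c r s * y $$ (r, s))"
    if "y \<in> carrier_mat n n" for y
    using has_rat_deriv0_unique[OF lie_act_has_rat_deriv0[OF M ab that] c[OF that]] .
  show ?thesis
    by (simp add: L[OF x] L sum_matrix_unit)
qed

text \<open>
  Differentiates an intertwining relation on the curves \<open>1 + t x\<close> and \<open>1 + t y\<close>. With \<open>x = y\<close> it says
  that morphisms of representations commute with the Lie algebra; with \<open>A\<close> the action of a group
  element \<open>g\<close> and \<open>g x = y g\<close> it says that the action of the Lie algebra is compatible with the
  adjoint action.
\<close>

lemma lie_act_intertwine:
  fixes M N :: "'a::alg_closed_field gl_rep"
  assumes M: "rational_rep n M" and N: "rational_rep n N"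
    and A: "A \<in> carrier_mat (rdim N) (rdim M)"
    and x: "x \<in> carrier_mat n n" and y: "y \<in> carrier_mat n n"
    and eq: "\<And>t. 1\<^sub>m n + t \<cdot>\<^sub>m x \<in> GL n \<Longrightarrow> 1\<^sub>m n + t \<cdot>\<^sub>m y \<in> GL n \<Longrightarrow>
      A * ract M (1\<^sub>m n + t \<cdot>\<^sub>m x) = ract N (1\<^sub>m n + t \<cdot>\<^sub>m y) * A"
  shows "A * lie_act n M x = lie_act n N y * A"
proof (rule eq_matI)
  fix a b assume "a < dim_row (lie_act n N y * A)" "b < dim_col (lie_act n N y * A)"
  then have ab: "a < rdim N" "b < rdim M"
    using A by (auto simp: lie_act_def)
  let ?gx = "\<lambda>t. 1\<^sub>m n + t \<cdot>\<^sub>m x" and ?gy = "\<lambda>t. 1\<^sub>m n + t \<cdot>\<^sub>m y"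
  obtain R where R: "poly R 0 \<noteq> 0" "\<And>t. poly R t \<noteq> 0 \<Longrightarrow> ?gx t \<in> GL n"
    using generic_one_plus_in_GL[OF x] by blast
  obtain S where S: "poly S 0 \<noteq> 0" "\<And>t. poly S t \<noteq> 0 \<Longrightarrow> ?gy t \<in> GL n"
    using generic_one_plus_in_GL[OF y] by blast
  have dl: "has_rat_deriv0 (\<lambda>t. \<Sum>c<rdim M. A $$ (a, c) * ract M (?gx t) $$ (c, b))
      (\<Sum>c<rdim M. A $$ (a, c) * lie_act n M x $$ (c, b))"
    using has_rat_deriv0_mult[OF has_rat_deriv0_const lie_act_has_rat_deriv0[OF M _ ab(2) x]]
    by (intro has_rat_deriv0_sum) auto
  have dr: "has_rat_deriv0 (\<lambda>t. \<Sum>c<rdim N. ract N (?gy t) $$ (a, c) * A $$ (c, b))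
      (\<Sum>c<rdim N. lie_act n N y $$ (a, c) * A $$ (c, b))"
    using has_rat_deriv0_mult[OF lie_act_has_rat_deriv0[OF N ab(1) _ y] has_rat_deriv0_const]
    by (intro has_rat_deriv0_sum) auto
  have "(\<Sum>c<rdim M. A $$ (a, c) * ract M (?gx t) $$ (c, b)) =
      (\<Sum>c<rdim N. ract N (?gy t) $$ (a, c) * A $$ (c, b))" if t: "poly (R * S) t \<noteq> 0" for t
  proof -
    have g: "?gx t \<in> GL n" "?gy t \<in> GL n"
      using t R S by auto
    then have d: "ract M (?gx t) \<in> carrier_mat (rdim M) (rdim M)"
      "ract N (?gy t) \<in> carrier_mat (rdim N) (rdim N)"
      using M N unfolding rational_rep_def by blast+
    show ?thesis
      using arg_cong[OF eq[OF g], of "\<lambda>B. B $$ (a, b)"] d A ab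
      by (simp add: scalar_prod_def lessThan_atLeast0)
  qed
  then have "has_rat_deriv0 (\<lambda>t. \<Sum>c<rdim N. ract N (?gy t) $$ (a, c) * A $$ (c, b))
      (\<Sum>c<rdim M. A $$ (a, c) * lie_act n M x $$ (c, b))"
    using has_rat_deriv0_cong[OF dl, of "R * S"] R S by simp
  from has_rat_deriv0_unique[OF this dr]
  show "(A * lie_act n M x) $$ (a, b) = (lie_act n N y * A) $$ (a, b)"
    using ab carrier_matD[OF A] by (simp add: scalar_prod_def lessThan_atLeast0 lie_act_def)
qed (use A in \<open>auto simp: lie_act_def\<close>)

section \<open>Kronecker products\<close>

lemma nat_block_less:
  fixes i c n m :: nat assumes "i < n" "c < m" shows "i * m + c < n * m"
proof -
  have "i * m + c < Suc i * m" using assms by simp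
  also have "\<dots> \<le> n * m" using assms by (intro mult_right_mono) auto
  finally show ?thesis .
qed
text \<open>
  An index of a tensor product is a pair of indices of the factors, so sums over it are double sums.
\<close>

lemma sum_div_mod:
  fixes f :: "nat \<Rightarrow> nat \<Rightarrow> 'a::comm_monoid_add" and n m :: nat
  shows
  "(\<Sum>k<n * m. f (k div m) (k mod m)) = (\<Sum>i<n. \<Sum>c<m. f i c)"
proof (cases "m = 0")
  case False
  have "(\<Sum>k<n * m. f (k div m) (k mod m)) = (\<Sum>(i, c)\<in>{..<n} \<times> {..<m}. f i c)"
    by (rule sum.reindex_bij_witness[where i = "\<lambda>(i, c). i * m + c" and j = "\<lambda>k. (k div m, k mod m)"])
      (use False in \<open>auto simp: less_mult_imp_div_less nat_block_less\<close>)
  then show ?thesis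
    by (simp add: sum.cartesian_product)
qed simp

lemma dim_kron [simp]:
  "dim_row (kron A B) = dim_row A * dim_row B" "dim_col (kron A B) = dim_col A * dim_col B"
  by (simp_all add: kron_def)

lemma kron_carrier [intro]:
  "A \<in> carrier_mat r c \<Longrightarrow> B \<in> carrier_mat r' c' \<Longrightarrow> kron A B \<in> carrier_mat (r * r') (c * c')"
  by (rule carrier_matI) auto

lemma kron_index:
  assumes "A \<in> carrier_mat r c" "B \<in> carrier_mat r' c'" "a < r * r'" "b < c * c'"
  shows "kron A B $$ (a, b) = A $$ (a div r', b div c') * B $$ (a mod r', b mod c')"
  using assms by (simp add: kron_def)

lemma mult_mat_index:
  assumes "A \<in> carrier_mat r s" "B \<in> carrier_mat s c" "a < r" "b < c"
  shows "(A * B) $$ (a, b) = (\<Sum>k<s. A $$ (a, k) * B $$ (k, b))"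
  using assms by (simp add: scalar_prod_def lessThan_atLeast0)

lemma div_mod_less_of_less_mult:
  assumes "(a::nat) < r * r'"
  shows "a div r' < r" "a mod r' < r'"
  using assms by (auto simp: less_mult_imp_div_less intro!: mod_less_divisor gr0I)

lemma kron_mult_kron:
  fixes A :: "'a::comm_semiring_1 mat"
  assumes A: "A \<in> carrier_mat r s" and B: "B \<in> carrier_mat r' s'"
    and C: "C \<in> carrier_mat s c" and D: "D \<in> carrier_mat s' c'"
  shows "kron A B * kron C D = kron (A * C) (B * D)"
proof (rule eq_matI)
  fix a b assume "a < dim_row (kron (A * C) (B * D))" "b < dim_col (kron (A * C) (B * D))"
  then have a: "a < r * r'" and b: "b < c * c'"
    using assms by auto
  let ?f = "\<lambda>i j. (A $$ (a div r', i) * C $$ (i, b div c')) * (B $$ (a mod r', j) * D $$ (j, b mod c'))"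
  have "(kron A B * kron C D) $$ (a, b) = (\<Sum>k<s * s'. kron A B $$ (a, k) * kron C D $$ (k, b))"
    using a b by (intro mult_mat_index[OF kron_carrier[OF A B] kron_carrier[OF C D]])
  also have "\<dots> = (\<Sum>k<s * s'. ?f (k div s') (k mod s'))"
    using a b by (intro sum.cong) (auto simp: kron_index[OF A B] kron_index[OF C D] ac_simps)
  also have "\<dots> = (A * C) $$ (a div r', b div c') * (B * D) $$ (a mod r', b mod c')"
    unfolding sum_div_mod[of ?f]
    using div_mod_less_of_less_mult[OF a] div_mod_less_of_less_mult[OF b]
    by (simp add: mult_mat_index[OF A C] mult_mat_index[OF B D] sum_product del: index_mult_mat)
  also have "\<dots> = kron (A * C) (B * D) $$ (a, b)"
    using kron_index[OF mult_carrier_mat[OF A C] mult_carrier_mat[OF B D] a b] by simp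
  finally show "(kron A B * kron C D) $$ (a, b) = kron (A * C) (B * D) $$ (a, b)" .
qed (use assms in auto)

lemma mod_mult_div_nat: "(x mod (y * z)) div z = (x div z) mod (y :: nat)"
proof (cases "z = 0")
  case False
  have "x mod (y * z) = z * (x div z mod y) + x mod z"
    using mod_mult2_eq[of x z y] by (simp add: mult.commute)
  then show ?thesis
    using False by simp
qed simp

lemma kron_assoc:
  fixes A :: "'a::comm_semiring_1 mat"
  shows "kron A (kron B C) = kron (kron A B) C"
proof (rule eq_matI)
  fix a b assume "a < dim_row (kron (kron A B) C)" "b < dim_col (kron (kron A B) C)"
  then have a: "a < dim_row A * dim_row B * dim_row C" and b: "b < dim_col A * dim_col B * dim_col C"
    by auto
  have a': "a < dim_row A * (dim_row B * dim_row C)" and b': "b < dim_col A * (dim_col B * dim_col C)"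
    using a b by (simp_all only: mult.assoc)
  have C: "A \<in> carrier_mat (dim_row A) (dim_col A)" "B \<in> carrier_mat (dim_row B) (dim_col B)"
    "C \<in> carrier_mat (dim_row C) (dim_col C)"
    by auto
  note * = div_mod_less_of_less_mult[OF a] div_mod_less_of_less_mult[OF b]
    div_mod_less_of_less_mult[OF a'] div_mod_less_of_less_mult[OF b']
  have d: "x div z div y = x div (y * z)" for x y z :: nat
    by (simp add: div_mult2_eq mult.commute[of y z])
  have m: "x mod (y * z) mod z = x mod z" for x y z :: nat
    by (simp add: mod_mod_cancel)
  show "kron A (kron B C) $$ (a, b) = kron (kron A B) C $$ (a, b)"
    unfolding kron_index[OF C(1) kron_carrier[OF C(2,3)] a' b']
      kron_index[OF C(2,3) *(6) *(8)] kron_index[OF kron_carrier[OF C(1,2)] C(3) a b]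
      kron_index[OF C(1,2) *(1) *(3)] d m mod_mult_div_nat
    by (rule mult.assoc[symmetric])
qed (simp_all add: mult.assoc)

lemma kron_one_one: "kron (1\<^sub>m r) (1\<^sub>m s) = (1\<^sub>m (r * s) :: 'a::comm_semiring_1 mat)"
proof (rule eq_matI)
  fix a b assume "a < dim_row (1\<^sub>m (r * s) :: 'a mat)" "b < dim_col (1\<^sub>m (r * s) :: 'a mat)"
  then have ab: "a < r * s" "b < r * s"
    by auto
  have "a = b" if "a div s = b div s" "a mod s = b mod s"
    using that by (metis div_mult_mod_eq)
  then show "kron (1\<^sub>m r) (1\<^sub>m s) $$ (a, b) = (1\<^sub>m (r * s) :: 'a mat) $$ (a, b)"
    using ab div_mod_less_of_less_mult[OF ab(1)] div_mod_less_of_less_mult[OF ab(2)]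
    by (auto simp: kron_def)
qed auto

lemma kron_one_right: "kron A (1\<^sub>m 1) = (A :: 'a::comm_semiring_1 mat)"
  by (rule eq_matI) (auto simp: kron_def)

section \<open>Place permutations\<close>

lemma tensor_place_less: "n > 0 \<Longrightarrow> tensor_place n d a k < n"
  by (simp add: tensor_place_def)

text \<open>
  An index of \<open>V\<^bsup>\<otimes>(e + d)\<^esup>\<close> splits by division by \<open>n ^ d\<close> into indices of \<open>V\<^bsup>\<otimes>e\<^esup>\<close> and \<open>V\<^bsup>\<otimes>d\<^esup>\<close>: the
  digits in the first \<open>e\<close> places are those of the quotient, the others those of the remainder.
\<close>

lemma tensor_place_append_left:
  "k \<le> e \<Longrightarrow> tensor_place n (e + d) a k = tensor_place n e (a div n ^ d) k"
  by (simp add: tensor_place_def div_mult2_eq[symmetric] power_add[symmetric] add.commute)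

lemma tensor_place_append_right:
  assumes "k \<in> {1..d}"
  shows "tensor_place n (e + d) a (e + k) = tensor_place n d (a mod n ^ d) k"
proof -
  have "n ^ d = n ^ k * n ^ (d - k)"
    using assms by (simp add: power_add[symmetric])
  then have "a mod n ^ d div n ^ (d - k) mod n = a div n ^ (d - k) mod n ^ k mod n"
    by (simp add: mod_mult_div_nat)
  also have "\<dots> = a div n ^ (d - k) mod n"
    using assms by (intro mod_mod_cancel) (auto simp: dvd_power)
  finally show ?thesis
    by (simp add: tensor_place_def)
qed

lemma tensor_place_first: "a < n ^ Suc d \<Longrightarrow> tensor_place n (Suc d) a (Suc 0) = a div n ^ d"
  by (simp add: tensor_place_def less_mult_imp_div_less)

lemma tensor_place_Suc:
  "k \<in> {1..d} \<Longrightarrow> tensor_place n (Suc d) a (Suc k) = tensor_place n d (a mod n ^ d) k"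
  using tensor_place_append_right[of k d n 1 a] by simp

lemma ball_atLeast1_Suc: "(\<forall>k\<in>{1..Suc d}. Q k) \<longleftrightarrow> Q 1 \<and> (\<forall>k\<in>{1..d}. Q (Suc k))"
proof -
  have "{1..Suc d} = insert 1 (Suc ` {1..d})"
    unfolding image_Suc_atLeastAtMost by auto
  then show ?thesis
    by (simp only: ball_simps)
qed

lemma tensor_place_inject:
  assumes "a < n ^ d" "b < n ^ d" "\<forall>k\<in>{1..d}. tensor_place n d a k = tensor_place n d b k"
  shows "a = b"
  using assms
proof (induction d arbitrary: a b)
  case (Suc d)
  have pos: "n ^ d > 0"
    using Suc.prems(1) by (cases n) auto
  have "a div n ^ d = b div n ^ d"
    "\<forall>k\<in>{1..d}. tensor_place n d (a mod n ^ d) k = tensor_place n d (b mod n ^ d) k"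
    using Suc.prems unfolding ball_atLeast1_Suc by (auto simp: tensor_place_first tensor_place_Suc)
  moreover from this(2) have "a mod n ^ d = b mod n ^ d"
    using pos by (intro Suc.IH) auto
  ultimately show ?case
    by (metis div_mult_mod_eq)
qed simp

text \<open>
  Together with injectivity this identifies the indices below \<open>n ^ d\<close> with words of length \<open>d\<close> in
  the letters below \<open>n\<close>, which reduces all matrix identities for place permutations to words.
\<close>

lemma tensor_place_surj:
  assumes "\<forall>k\<in>{1..d}. f k < n"
  obtains a where "a < n ^ d" "\<forall>k\<in>{1..d}. tensor_place n d a k = f k"
proof -
  have "\<exists>a<n ^ d. \<forall>k\<in>{1..d}. tensor_place n d a k = f k"
    using assms
  proof (induction d arbitrary: f)
    case (Suc d)
    obtain a where a: "a < n ^ d" "\<forall>k\<in>{1..d}. tensor_place n d a k = f (Suc k)"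
      using Suc.IH[of "f \<circ> Suc"] Suc.prems by auto
    have f1: "f 1 < n"
      using Suc.prems by simp
    have "f 1 * n ^ d + a < n ^ Suc d"
      using nat_block_less[OF f1 a(1)] by simp
    then show ?case
      using a unfolding ball_atLeast1_Suc
      by (intro exI[of _ "f 1 * n ^ d + a"])
        (auto simp: tensor_place_first tensor_place_Suc div_add1_eq[of _ a])
  qed simp
  then show thesis
    using that by blast
qed

lemma place_perm_carrier [simp]: "place_perm n d \<sigma> \<in> carrier_mat (n ^ d) (n ^ d)"
  by (simp add: place_perm_def)

lemma place_perm_dim [simp]: "dim_row (place_perm n d \<sigma>) = n ^ d" "dim_col (place_perm n d \<sigma>) = n ^ d"
  by (simp_all add: place_perm_def)

lemma place_perm_index:
  "a < n ^ d \<Longrightarrow> b < n ^ d \<Longrightarrow> place_perm n d \<sigma> $$ (a, b) =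
     (if \<forall>k\<in>{1..d}. tensor_place n d a (\<sigma> k) = tensor_place n d b k then 1 else 0)"
  by (simp add: place_perm_def)

lemma place_perm_id: "place_perm n d id = 1\<^sub>m (n ^ d)"
proof (rule eq_matI)
  fix a b assume "a < dim_row (1\<^sub>m (n ^ d) :: 'a mat)" "b < dim_col (1\<^sub>m (n ^ d) :: 'a mat)"
  then show "place_perm n d id $$ (a, b) = (1\<^sub>m (n ^ d) :: 'a mat) $$ (a, b)"
    using tensor_place_inject[of a n d b] by (auto simp: place_perm_index)
qed auto

lemma power_pos_of_less: "(a::nat) < n ^ d \<Longrightarrow> k \<in> {1..d} \<Longrightarrow> n > 0"
  by (cases n) (auto simp: power_0_left split: if_splits)

text \<open>
  A place permutation has a single entry \<open>1\<close> in each row, so multiplying by it from the left merely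
  selects rows: row \<open>a\<close> of the product is row \<open>c\<close> of \<open>B\<close>, where the word of \<open>c\<close> is that of \<open>a\<close> composed
  with \<open>\<sigma>\<close>.
\<close>

lemma place_perm_mult_index:
  fixes B :: "'a::comm_semiring_1 mat"
  assumes "B \<in> carrier_mat (n ^ d) m" "a < n ^ d" "b < m" "c < n ^ d"
    and c: "\<forall>k\<in>{1..d}. tensor_place n d a (\<sigma> k) = tensor_place n d c k"
  shows "(place_perm n d \<sigma> * B) $$ (a, b) = B $$ (c, b)"
proof -
  have "(\<forall>k\<in>{1..d}. tensor_place n d a (\<sigma> k) = tensor_place n d e k) \<longleftrightarrow> e = c"
    if "e < n ^ d" for e
    using c tensor_place_inject[OF that assms(4)] by auto
  then have "(\<Sum>e<n ^ d. place_perm n d \<sigma> $$ (a, e) * B $$ (e, b)) =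
      (\<Sum>e<n ^ d. if e = c then B $$ (e, b) else 0)"
    using assms by (intro sum.cong) (auto simp: place_perm_index)
  then show ?thesis
    using assms(4) by (simp add: mult_mat_index[OF place_perm_carrier assms(1-3)] del: index_mult_mat)
qed

lemma mult_place_perm_index:
  fixes B :: "'a::comm_semiring_1 mat"
  assumes "B \<in> carrier_mat m (n ^ d)" "a < m" "b < n ^ d" "c < n ^ d" "\<sigma> permutes {1..d}"
    and c: "\<forall>k\<in>{1..d}. tensor_place n d c (\<sigma> k) = tensor_place n d b k"
  shows "(B * place_perm n d \<sigma>) $$ (a, b) = B $$ (a, c)"
proof -
  have "e = c" if "e < n ^ d" "\<forall>k\<in>{1..d}. tensor_place n d e (\<sigma> k) = tensor_place n d b k" for e
  proof (rule tensor_place_inject[OF that(1) assms(4)], rule ballI)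
    fix k assume "k \<in> {1..d}"
    then obtain l where "l \<in> {1..d}" "k = \<sigma> l"
      using permutes_image[OF assms(5)] by (metis imageE)
    then show "tensor_place n d e k = tensor_place n d c k"
      using that(2) c by simp
  qed
  then have "(\<forall>k\<in>{1..d}. tensor_place n d e (\<sigma> k) = tensor_place n d b k) \<longleftrightarrow> e = c"
    if "e < n ^ d" for e
    using c that by blast
  then have "(\<Sum>e<n ^ d. B $$ (a, e) * place_perm n d \<sigma> $$ (e, b)) =
      (\<Sum>e<n ^ d. if e = c then B $$ (a, e) else 0)"
    using assms by (intro sum.cong) (auto simp: place_perm_index)
  then show ?thesis
    using assms(4) by (simp add: mult_mat_index[OF assms(1) place_perm_carrier assms(2,3)] del: index_mult_mat)
qed

lemma place_perm_mult:
  assumes \<sigma>: "\<sigma> permutes {1..d}" and \<tau>: "\<tau> permutes {1..d}"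
  shows "place_perm n d \<sigma> * place_perm n d \<tau> = (place_perm n d (\<sigma> \<circ> \<tau>) :: 'a::comm_semiring_1 mat)"
proof (rule eq_matI)
  fix a b assume "a < dim_row (place_perm n d (\<sigma> \<circ> \<tau>) :: 'a mat)"
    "b < dim_col (place_perm n d (\<sigma> \<circ> \<tau>) :: 'a mat)"
  then have ab: "a < n ^ d" "b < n ^ d"
    by auto
  have "\<forall>k\<in>{1..d}. tensor_place n d a (\<sigma> k) < n"
    using tensor_place_less power_pos_of_less[OF ab(1)] by blast
  then obtain c where c: "c < n ^ d" "\<forall>k\<in>{1..d}. tensor_place n d c k = tensor_place n d a (\<sigma> k)"
    by (rule tensor_place_surj)
  have "(place_perm n d \<sigma> * place_perm n d \<tau>) $$ (a, b) = (place_perm n d \<tau> $$ (c, b) :: 'a)"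
    using c ab by (intro place_perm_mult_index[where m = "n ^ d"]) auto
  also have "\<dots> = place_perm n d (\<sigma> \<circ> \<tau>) $$ (a, b)"
    using c ab permutes_in_image[OF \<tau>] by (auto simp: place_perm_index)
  finally show "(place_perm n d \<sigma> * place_perm n d \<tau>) $$ (a, b) =
      (place_perm n d (\<sigma> \<circ> \<tau>) $$ (a, b) :: 'a)" .
qed auto

text \<open>
  Permuting the first \<open>e\<close> places by \<open>\<sigma>\<close> and the last \<open>d\<close> by \<open>\<tau>\<close> is one permutation \<open>\<rho>\<close> of all the
  places. It is used with one of the two factors the identity, to see \<open>T\<close> and the functor \<open>F\<close> on
  tensor powers inside the symmetric group.
\<close>

lemma kron_place_perm:
  fixes \<sigma> \<tau> \<rho> :: "nat \<Rightarrow> nat"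
  assumes \<sigma>: "\<sigma> permutes {1..e}" and \<tau>: "\<tau> permutes {1..d}"
    and \<rho>: "\<And>k. k \<in> {1..e} \<Longrightarrow> \<rho> k = \<sigma> k" "\<And>k. k \<in> {1..d} \<Longrightarrow> \<rho> (e + k) = e + \<tau> k"
  shows "kron (place_perm n e \<sigma>) (place_perm n d \<tau>) =
    (place_perm n (e + d) \<rho> :: 'a::comm_semiring_1 mat)"
proof (rule eq_matI)
  fix a b assume "a < dim_row (place_perm n (e + d) \<rho> :: 'a mat)"
    "b < dim_col (place_perm n (e + d) \<rho> :: 'a mat)"
  then have ab: "a < n ^ (e + d)" "b < n ^ (e + d)"
    by auto
  then have ab': "a < n ^ e * n ^ d" "b < n ^ e * n ^ d"
    by (auto simp: power_add)
  have "{1..e + d} = {1..e} \<union> (\<lambda>k. e + k) ` {1..d}"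
  proof -
    have "k \<in> (\<lambda>k. e + k) ` {1..d}" if "k \<in> {1..e + d}" "k \<notin> {1..e}" for k
      using that by (intro image_eqI[of _ _ "k - e"]) auto
    then show ?thesis
      by auto
  qed
  moreover have "tensor_place n (e + d) a (\<rho> k) = tensor_place n e (a div n ^ d) (\<sigma> k)"
    if "k \<in> {1..e}" for k
    using that \<rho>(1)[OF that] permutes_in_image[OF \<sigma>, of k] by (simp add: tensor_place_append_left)
  moreover have "tensor_place n (e + d) b k = tensor_place n e (b div n ^ d) k" if "k \<in> {1..e}" for k
    using that by (simp add: tensor_place_append_left)
  moreover have "tensor_place n (e + d) a (\<rho> (e + k)) = tensor_place n d (a mod n ^ d) (\<tau> k)"
    if "k \<in> {1..d}" for k
    using that \<rho>(2)[OF that] permutes_in_image[OF \<tau>, of k] tensor_place_append_right by simp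
  moreover have "tensor_place n (e + d) b (e + k) = tensor_place n d (b mod n ^ d) k"
    if "k \<in> {1..d}" for k
    using that by (rule tensor_place_append_right)
  ultimately have "(\<forall>k\<in>{1..e + d}. tensor_place n (e + d) a (\<rho> k) = tensor_place n (e + d) b k) \<longleftrightarrow>
      (\<forall>k\<in>{1..e}. tensor_place n e (a div n ^ d) (\<sigma> k) = tensor_place n e (b div n ^ d) k) \<and>
      (\<forall>k\<in>{1..d}. tensor_place n d (a mod n ^ d) (\<tau> k) = tensor_place n d (b mod n ^ d) k)"
    by (simp only: ball_Un ball_simps) auto
  then show "kron (place_perm n e \<sigma>) (place_perm n d \<tau>) $$ (a, b) =
      (place_perm n (e + d) \<rho> $$ (a, b) :: 'a)"
    using ab' div_mod_less_of_less_mult[OF ab'(1)] div_mod_less_of_less_mult[OF ab'(2)]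
    by (simp add: kron_index[OF place_perm_carrier place_perm_carrier] place_perm_index[OF ab]
        place_perm_index)
qed (auto simp: power_add)

section \<open>Polynomial representations and the functor \<open>F\<close>\<close>

lemma GL_carrier: "g \<in> GL n \<Longrightarrow> g \<in> carrier_mat n n"
  by (simp add: GL_def)

lemma mat_diag_in_GL:
  assumes "\<forall>i<n. t i \<noteq> (0 :: 'a::field)"
  shows "mat_diag n t \<in> GL n"
proof -
  have "mat_diag n t * mat_diag n (\<lambda>i. inverse (t i)) = 1\<^sub>m n"
    unfolding mat_diag_diag using assms by (intro eq_matI) (auto simp: mat_diag_def)
  then have "det (mat_diag n t) * det (mat_diag n (\<lambda>i. inverse (t i))) = 1"
    by (metis det_mult det_one mat_diag_dim)
  then show ?thesis
    by (auto simp: GL_def)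
qed

lemma rational_rep_carrier:
  "rational_rep n M \<Longrightarrow> g \<in> GL n \<Longrightarrow> ract M g \<in> carrier_mat (rdim M) (rdim M)"
  by (simp add: rational_rep_def)

lemma rational_rep_mult:
  "rational_rep n M \<Longrightarrow> g \<in> GL n \<Longrightarrow> h \<in> GL n \<Longrightarrow> ract M (g * h) = ract M g * ract M h"
  by (simp add: rational_rep_def)

lemma Rep_rational: "M \<in> Rep n d \<Longrightarrow> rational_rep n M"
  by (simp add: Rep_def)

lemma F_obj_simps [simp]:
  "rdim (F_obj n M) = n * rdim M" "ract (F_obj n M) g = kron g (ract M g)"
  by (simp_all add: F_obj_def)

lemma F_obj_rational:
  assumes M: "rational_rep n M"
  shows "rational_rep n (F_obj n M)"
  unfolding rational_rep_def F_obj_simps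
proof (intro conjI ballI allI impI)
  fix g :: "'a mat" assume g: "g \<in> GL n"
  show "kron g (ract M g) \<in> carrier_mat (n * rdim M) (n * rdim M)"
    by (intro kron_carrier GL_carrier rational_rep_carrier[OF M] g)
  fix h :: "'a mat" assume h: "h \<in> GL n"
  show "kron (g * h) (ract M (g * h)) = kron g (ract M g) * kron h (ract M h)"
    by (simp add: rational_rep_mult[OF M g h] kron_mult_kron[OF GL_carrier[OF g]
          rational_rep_carrier[OF M g] GL_carrier[OF h] rational_rep_carrier[OF M h]])
next
  show "kron (1\<^sub>m n) (ract M (1\<^sub>m n)) = 1\<^sub>m (n * rdim M)"
    using M by (simp add: rational_rep_def kron_one_one)
next
  fix p q assume p: "p < n * rdim M" and q: "q < n * rdim M"
  obtain f where f: "f \<in> regular n"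
    "\<And>g. g \<in> GL n \<Longrightarrow> ract M g $$ (p mod rdim M, q mod rdim M) = f g"
    using M div_mod_less_of_less_mult[OF p] div_mod_less_of_less_mult[OF q]
    unfolding rational_rep_def by metis
  show "\<exists>f\<in>regular n. \<forall>g\<in>GL n. kron g (ract M g) $$ (p, q) = f g"
  proof
    show "(\<lambda>g. g $$ (p div rdim M, q div rdim M) * f g) \<in> regular n"
      using div_mod_less_of_less_mult[OF p] div_mod_less_of_less_mult[OF q]
      by (intro regular.mult regular.coord f(1))
    show "\<forall>g\<in>GL n. kron g (ract M g) $$ (p, q) = g $$ (p div rdim M, q div rdim M) * f g"
      using f(2) kron_index[OF GL_carrier rational_rep_carrier[OF M] p q] by simp
  qed
qed

lemma mult_mat_vec_index:
  assumes "A \<in> carrier_mat r s" "v \<in> carrier_vec s" "a < r"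
  shows "(A *\<^sub>v v) $ a = (\<Sum>k<s. A $$ (a, k) * v $ k)"
  using assms by (auto simp: scalar_prod_def lessThan_atLeast0)

text \<open>
  The torus acts on \<open>e\<^sub>i \<otimes> M\<close> through \<open>M\<close> twisted by the \<open>i\<close>-th coordinate character. Hence a
  weight vector of \<open>V \<otimes> M\<close> has components \<open>e\<^sub>i \<otimes> w\<close> where \<open>w\<close>, if nonzero, is a weight vector of
  \<open>M\<close> whose weight is smaller by the \<open>i\<close>-th unit vector.
\<close>

lemma F_obj_weight:
  fixes M :: "'a::field gl_rep"
  assumes M: "rational_rep n M" and \<mu>: "is_weight n (F_obj n M) \<mu>"
  obtains i where "i < n" "is_weight n M (\<lambda>j. \<mu> j - (if j = i then 1 else 0))"
proof -
  let ?m = "rdim M"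
  obtain v where v: "v \<in> carrier_vec (n * ?m)" "v \<noteq> 0\<^sub>v (n * ?m)"
    and vt: "\<And>t. \<forall>i<n. t i \<noteq> 0 \<Longrightarrow>
      kron (mat_diag n t) (ract M (mat_diag n t)) *\<^sub>v v = (\<Prod>i<n. t i powi \<mu> i) \<cdot>\<^sub>v v"
    using \<mu> unfolding is_weight_def F_obj_simps by blast
  have "\<exists>p<n * ?m. v $ p \<noteq> 0"
  proof (rule ccontr)
    assume "\<not> ?thesis"
    then have "v = 0\<^sub>v (n * ?m)"
      using v(1) by (intro eq_vecI) auto
    then show False
      using v(2) by contradiction
  qed
  then obtain p where p: "p < n * ?m" "v $ p \<noteq> 0"
    by blast
  \<comment> \<open>The block that contains the nonzero entry \<open>p\<close> of \<open>v\<close>.\<close>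
  define i where "i = p div ?m"
  have i: "i < n" and pm: "p mod ?m < ?m"
    using div_mod_less_of_less_mult[OF p(1)] by (auto simp: i_def)
  define w where "w = vec ?m (\<lambda>c. v $ (i * ?m + c))"
  have "w $ (p mod ?m) \<noteq> 0"
    using p(2) pm by (simp add: w_def i_def)
  then have w0: "w \<noteq> 0\<^sub>v ?m"
    using pm by auto
  have "ract M (mat_diag n t) *\<^sub>v w = (\<Prod>j<n. t j powi (\<mu> j - (if j = i then 1 else 0))) \<cdot>\<^sub>v w"
    (is "?R *\<^sub>v w = ?c' \<cdot>\<^sub>v w") if t: "\<forall>i<n. t i \<noteq> 0" for t
  proof (rule eq_vecI)
    have R: "?R \<in> carrier_mat ?m ?m"
      by (intro rational_rep_carrier[OF M] mat_diag_in_GL t)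
    then show "dim_vec (?R *\<^sub>v w) = dim_vec (?c' \<cdot>\<^sub>v w)"
      by (simp add: w_def)
    fix c assume "c < dim_vec (?c' \<cdot>\<^sub>v w)"
    then have c: "c < ?m"
      by (simp add: w_def)
    let ?K = "kron (mat_diag n t) ?R"
    have ic: "i * ?m + c < n * ?m"
      by (rule nat_block_less[OF i c])
    have K: "?K \<in> carrier_mat (n * ?m) (n * ?m)"
      by (intro kron_carrier R mat_diag_dim)
    have ti: "t i \<noteq> 0"
      using t i by blast
    let ?f = "\<lambda>k e. (if k = i then t i else 0) * (?R $$ (c, e) * v $ (k * ?m + e))"
    have "(\<Prod>j<n. t j powi \<mu> j) * w $ c = (?K *\<^sub>v v) $ (i * ?m + c)"
      using vt[OF t] v(1) ic c by (simp add: w_def)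
    also have "\<dots> = (\<Sum>k<n * ?m. ?K $$ (i * ?m + c, k) * v $ k)"
      by (rule mult_mat_vec_index[OF K v(1) ic])
    also have "\<dots> = (\<Sum>k<n * ?m. ?f (k div ?m) (k mod ?m))"
    proof (rule sum.cong)
      fix k assume "k \<in> {..<n * ?m}"
      then have k: "k < n * ?m"
        by simp
      show "?K $$ (i * ?m + c, k) * v $ k = ?f (k div ?m) (k mod ?m)"
        unfolding kron_index[OF mat_diag_dim R ic k] using c i div_mod_less_of_less_mult(1)[OF k]
        by (simp add: mat_diag_def)
    qed simp
    also have "\<dots> = (\<Sum>k<n. if k = i then t i * (\<Sum>e<?m. ?R $$ (c, e) * v $ (k * ?m + e)) else 0)"
      unfolding sum_div_mod[of ?f] by (intro sum.cong) (auto simp: sum_distrib_left)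
    also have "\<dots> = t i * (?R *\<^sub>v w) $ c"
      using R i c by (simp add: scalar_prod_def lessThan_atLeast0 w_def)
    finally have e: "(\<Prod>j<n. t j powi \<mu> j) * w $ c = t i * (?R *\<^sub>v w) $ c" .
    have "?c' * t i = ?c' * (\<Prod>j<n. if j = i then t i else 1)"
      using i by simp
    also have "\<dots> = (\<Prod>j<n. t j powi \<mu> j)"
      unfolding prod.distrib[symmetric]
    proof (rule prod.cong)
      fix j assume j: "j \<in> {..<n}"
      show "t j powi (\<mu> j - (if j = i then 1 else 0)) * (if j = i then t i else 1) = t j powi \<mu> j"
        using t j power_int_minus_mult[of "t j" "\<mu> j"] by auto
    qed simp
    finally have c': "?c' * t i = (\<Prod>j<n. t j powi \<mu> j)" .
    have "t i * (?c' * w $ c) = ?c' * t i * w $ c"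
      by (rule mult.left_commute[THEN trans], rule mult.assoc[symmetric])
    then have "t i * (?c' * w $ c) = t i * (?R *\<^sub>v w) $ c"
      unfolding c' e .
    then show "(?R *\<^sub>v w) $ c = (?c' \<cdot>\<^sub>v w) $ c"
      using ti c by (simp add: w_def)
  qed
  then have "is_weight n M (\<lambda>j. \<mu> j - (if j = i then 1 else 0))"
    unfolding is_weight_def using w0 by (intro bexI[of _ w]) (auto simp: w_def)
  then show thesis
    using that i by blast
qed

lemma F_obj_Rep:
  fixes M :: "'a::field gl_rep"
  assumes M: "M \<in> Rep n d"
  shows "F_obj n M \<in> Rep n (Suc d)"
  unfolding Rep_def mem_Collect_eq
proof (intro conjI allI impI)
  show "rational_rep n (F_obj n M)"
    by (intro F_obj_rational Rep_rational[OF M])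
  fix \<mu> assume "is_weight n (F_obj n M) \<mu>"
  then obtain i where i: "i < n" "is_weight n M (\<lambda>j. \<mu> j - (if j = i then 1 else 0))"
    using F_obj_weight[OF Rep_rational[OF M]] by blast
  then have ge: "\<forall>j<n. 0 \<le> \<mu> j - (if j = i then 1 else 0)"
    and s: "(\<Sum>j<n. \<mu> j - (if j = i then 1 else 0)) = int d"
    using M unfolding Rep_def by blast+
  show "0 \<le> \<mu> j" if "j < n" for j
    using ge[rule_format, OF that] by (auto split: if_splits)
  show "(\<Sum>j<n. \<mu> j) = int (Suc d)"
    using s i(1) by (simp add: sum_subtractf)
qed

text \<open>
  Characters of the multiplicative group are determined by their exponents, because the field is
  infinite. The trivial module therefore has the weight \<open>0\<close> only.
\<close>

lemma power_int_eq_one_imp_zero: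
  assumes "\<And>s :: 'a::alg_closed_field. s \<noteq> 0 \<Longrightarrow> s powi k = 1"
  shows "k = 0"
proof (rule ccontr)
  assume k: "k \<noteq> 0"
  define e where "e = nat \<bar>k\<bar>"
  have e: "e > 0"
    using k by (simp add: e_def)
  have pow: "s ^ e = 1" if "s \<noteq> 0" for s :: 'a
    using assms[OF that] by (cases "k \<ge> 0") (auto simp: e_def power_int_def inverse_eq_1_iff power_inverse)
  \<comment> \<open>The factor \<open>[:0, 1:]\<close> takes care of the point \<open>0\<close>, where nothing is assumed.\<close>
  define P :: "'a poly" where "P = [:0, 1:] * ([:0, 1:] ^ e - 1)"
  have "poly P s = 0" for s
    using pow[of s] by (cases "s = 0") (auto simp: P_def)
  then have "P = 0"
    using poly_roots_finite[of P] alg_closed_field_infinite by fastforce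
  then have "[:0, 1:] ^ e = (1 :: 'a poly)"
    by (simp add: P_def)
  then have "poly ([:0, 1:] ^ e) 0 = (1 :: 'a)"
    by simp
  then show False
    using zero_power[OF e, where 'a = 'a] by simp
qed

lemma tensor_power_Rep: "tensor_power n d \<in> (Rep n d :: 'a::alg_closed_field gl_rep set)"
proof (induction d)
  case 0
  let ?M = "tensor_power n 0 :: 'a gl_rep"
  have "rational_rep n ?M"
    unfolding rational_rep_def by (auto intro: regular.const)
  moreover have zero: "\<mu> i = 0" if \<mu>: "is_weight n ?M \<mu>" and i: "i < n" for \<mu> i
  proof (rule power_int_eq_one_imp_zero)
    fix s :: 'a assume s: "s \<noteq> 0"
    obtain v :: "'a vec" where v: "v \<in> carrier_vec 1" "v \<noteq> 0\<^sub>v 1"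
      "\<And>t. \<forall>i<n. t i \<noteq> 0 \<Longrightarrow> 1\<^sub>m 1 *\<^sub>v v = (\<Prod>i<n. t i powi \<mu> i) \<cdot>\<^sub>v v"
      using \<mu> unfolding is_weight_def by auto
    have v0: "v $ 0 \<noteq> 0"
      using v(1,2) by (metis eq_vecI carrier_vecD index_zero_vec less_one)
    define t where "t = (\<lambda>j. if j = i then s else 1)"
    have "v = (\<Prod>j<n. t j powi \<mu> j) \<cdot>\<^sub>v v"
      using v(1) v(3)[of t] s by (simp add: t_def)
    from arg_cong[OF this, of "\<lambda>u. u $ 0"] have "(\<Prod>j<n. t j powi \<mu> j) = 1"
      using v(1) v0 by simp
    moreover have "(\<Prod>j<n. t j powi \<mu> j) = (\<Prod>j<n. if j = i then s powi \<mu> i else 1)"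
      by (intro prod.cong) (auto simp: t_def)
    ultimately show "s powi \<mu> i = 1"
      using i by simp
  qed
  ultimately show ?case
    unfolding Rep_def by (auto simp: zero simp del: tensor_power.simps)
next
  case (Suc d)
  then show ?case
    by (simp add: F_obj_Rep)
qed

lemma rdim_tensor_power [simp]: "rdim (tensor_power n d) = n ^ d"
  by (induction d) auto

lemma ract_tensor_power_carrier:
  "g \<in> carrier_mat n n \<Longrightarrow> ract (tensor_power n d) g \<in> carrier_mat (n ^ d) (n ^ d)"
  by (induction d) auto

lemma prod_atLeast1_Suc:
  "(\<Prod>k=1..Suc d. f k) = f (Suc 0) * (\<Prod>k=1..d. f (Suc k) :: 'a::comm_monoid_mult)"
proof -
  have "{1..Suc d} = insert (Suc 0) (Suc ` {1..d})"
    unfolding image_Suc_atLeastAtMost by auto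
  then have "(\<Prod>k=1..Suc d. f k) = prod f (insert (Suc 0) (Suc ` {1..d}))"
    by (rule arg_cong)
  also have "\<dots> = f (Suc 0) * (\<Prod>k=1..d. f (Suc k))"
    by (subst prod.insert) (auto simp: prod.reindex simp del: image_Suc_atLeastAtMost)
  finally show ?thesis .
qed

lemma ract_tensor_power_index:
  assumes g: "g \<in> carrier_mat n n" and "a < n ^ d" "b < n ^ d"
  shows "ract (tensor_power n d) g $$ (a, b) =
    (\<Prod>k=1..d. g $$ (tensor_place n d a k, tensor_place n d b k))"
  using assms(2,3)
proof (induction d arbitrary: a b)
  case (Suc d)
  have a: "a < n * n ^ d" and b: "b < n * n ^ d"
    using Suc.prems by auto
  note ab = div_mod_less_of_less_mult[OF a] div_mod_less_of_less_mult[OF b]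
  have "(\<Prod>k=1..Suc d. g $$ (tensor_place n (Suc d) a k, tensor_place n (Suc d) b k)) =
      g $$ (a div n ^ d, b div n ^ d) *
      (\<Prod>k=1..d. g $$ (tensor_place n (Suc d) a (Suc k), tensor_place n (Suc d) b (Suc k)))"
    unfolding prod_atLeast1_Suc using Suc.prems by (simp only: tensor_place_first)
  also have "\<dots> = g $$ (a div n ^ d, b div n ^ d) *
      ract (tensor_power n d) g $$ (a mod n ^ d, b mod n ^ d)"
    using ab by (simp add: Suc.IH tensor_place_Suc)
  also have "\<dots> = ract (tensor_power n (Suc d)) g $$ (a, b)"
    using kron_index[OF g ract_tensor_power_carrier[OF g] a b] by simp
  finally show ?case ..
qed simp

section \<open>Equivariant maps\<close>

lemma gl_hom_carrier: "A \<in> gl_hom n M N \<Longrightarrow> A \<in> carrier_mat (rdim N) (rdim M)"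
  by (simp add: gl_hom_def)

lemma gl_hom_equivariant: "A \<in> gl_hom n M N \<Longrightarrow> g \<in> GL n \<Longrightarrow> A * ract M g = ract N g * A"
  by (simp add: gl_hom_def)

lemma gl_hom_one: "rational_rep n M \<Longrightarrow> 1\<^sub>m (rdim M) \<in> gl_hom n M M"
  by (auto simp: gl_hom_def dest: rational_rep_carrier)

lemma gl_hom_mult:
  assumes M: "rational_rep n M" "rational_rep n N" "rational_rep n P"
    and A: "A \<in> gl_hom n N P" and B: "B \<in> gl_hom n M N"
  shows "A * B \<in> gl_hom n M P"
  unfolding gl_hom_def mem_Collect_eq
proof (intro conjI ballI)
  note dA = gl_hom_carrier[OF A] and dB = gl_hom_carrier[OF B]
  show "A * B \<in> carrier_mat (rdim P) (rdim M)"
    using dA dB by (rule mult_carrier_mat)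
  fix g :: "'a mat" assume g: "g \<in> GL n"
  note d = M[THEN rational_rep_carrier, OF g]
  have "A * B * ract M g = A * (ract N g * B)"
    using assoc_mult_mat[OF dA dB d(1)] gl_hom_equivariant[OF B g] by simp
  also have "\<dots> = ract P g * A * B"
    using assoc_mult_mat[OF dA d(2) dB] gl_hom_equivariant[OF A g] by simp
  finally show "A * B * ract M g = ract P g * (A * B)"
    using assoc_mult_mat[OF d(3) dA dB] by simp
qed

lemma gl_hom_F_map:
  assumes "rational_rep n M" "rational_rep n N" and A: "A \<in> gl_hom n M N"
  shows "F_map n A \<in> gl_hom n (F_obj n M) (F_obj n N)"
  unfolding gl_hom_def mem_Collect_eq F_obj_simps F_map_def
proof (intro conjI ballI)
  note dA = gl_hom_carrier[OF A]
  show "kron (1\<^sub>m n) A \<in> carrier_mat (n * rdim N) (n * rdim M)"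
    by (intro kron_carrier dA one_carrier_mat)
  fix g :: "'a mat" assume g: "g \<in> GL n"
  note d = assms(1,2)[THEN rational_rep_carrier, OF g]
  show "kron (1\<^sub>m n) A * kron g (ract M g) = kron g (ract N g) * kron (1\<^sub>m n) A"
    using GL_carrier[OF g] gl_hom_equivariant[OF A g]
    by (simp add: kron_mult_kron[OF one_carrier_mat dA GL_carrier[OF g] d(1)]
        kron_mult_kron[OF GL_carrier[OF g] d(2) one_carrier_mat dA])
qed

text \<open>
  The entry of \<open>g\<^bsup>\<otimes>d\<^esup>\<close> at two words is the product of the entries of \<open>g\<close> at their letters in equal
  places, and this product does not change when both words are permuted by \<open>\<sigma>\<close>.
\<close>

lemma place_perm_gl_hom:
  assumes \<sigma>: "\<sigma> permutes {1..d}"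
  shows "place_perm n d \<sigma> \<in> gl_hom n (tensor_power n d) (tensor_power n d :: 'a::field gl_rep)"
  unfolding gl_hom_def mem_Collect_eq rdim_tensor_power
proof (intro conjI ballI place_perm_carrier)
  fix g :: "'a mat" assume "g \<in> GL n"
  then have g: "g \<in> carrier_mat n n"
    by (rule GL_carrier)
  let ?G = "ract (tensor_power n d) g"
  note G = ract_tensor_power_carrier[OF g, of d]
  show "place_perm n d \<sigma> * ?G = ?G * place_perm n d \<sigma>"
  proof (rule eq_matI)
    fix a b assume "a < dim_row (?G * place_perm n d \<sigma>)" "b < dim_col (?G * place_perm n d \<sigma>)"
    then have ab: "a < n ^ d" "b < n ^ d"
      using G by auto
    have "\<forall>k\<in>{1..d}. tensor_place n d a (\<sigma> k) < n"
      "\<forall>k\<in>{1..d}. tensor_place n d b (Hilbert_Choice.inv \<sigma> k) < n"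
      using tensor_place_less power_pos_of_less[OF ab(1)] by blast+
    from tensor_place_surj[OF this(1)] tensor_place_surj[OF this(2)]
    obtain c e where c: "c < n ^ d" "\<forall>k\<in>{1..d}. tensor_place n d c k = tensor_place n d a (\<sigma> k)"
      and e: "e < n ^ d"
        "\<forall>k\<in>{1..d}. tensor_place n d e k = tensor_place n d b (Hilbert_Choice.inv \<sigma> k)"
      by metis
    have e': "\<forall>k\<in>{1..d}. tensor_place n d e (\<sigma> k) = tensor_place n d b k"
      using e(2) permutes_in_image[OF \<sigma>] permutes_inverses[OF \<sigma>] by auto
    have "(place_perm n d \<sigma> * ?G) $$ (a, b) = ?G $$ (c, b)"
      using c(2) by (intro place_perm_mult_index[OF G ab(1,2) c(1)]) simp
    also have "\<dots> = (\<Prod>k=1..d. g $$ (tensor_place n d a (\<sigma> k), tensor_place n d e (\<sigma> k)))"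
      unfolding ract_tensor_power_index[OF g c(1) ab(2)] using c(2) e' by (intro prod.cong) auto
    also have "\<dots> = (\<Prod>k=1..d. g $$ (tensor_place n d a k, tensor_place n d e k))"
      by (rule prod.permute[OF \<sigma>, symmetric, unfolded o_def])
    also have "\<dots> = (?G * place_perm n d \<sigma>) $$ (a, b)"
      using mult_place_perm_index[OF G ab(1,2) e(1) \<sigma> e'] ract_tensor_power_index[OF g ab(1) e(1)]
      by simp
    finally show "(place_perm n d \<sigma> * ?G) $$ (a, b) = (?G * place_perm n d \<sigma>) $$ (a, b)" .
  qed (use G in auto)
qed

section \<open>The endomorphisms \<open>X\<close> and \<open>T\<close> of \<open>F\<close>\<close>

lemma X_F_carrier [simp]: "X_F n M \<in> carrier_mat (n * rdim M) (n * rdim M)"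
  by (simp add: X_F_def)

text \<open>
  In block form: since \<open>E\<^sub>i\<^sub>j \<otimes> E\<^sub>j\<^sub>i\<close> contributes to the block \<open>(i, j)\<close> only, that block of \<open>X\<close> is the
  action of \<open>E\<^sub>j\<^sub>i\<close>.
\<close>

lemma X_F_index:
  assumes p: "p < n * rdim M" and q: "q < n * rdim M"
  shows "X_F n M $$ (p, q) =
    lie_act n M (matrix_unit n (q div rdim M) (p div rdim M)) $$ (p mod rdim M, q mod rdim M)"
proof -
  note pq = div_mod_less_of_less_mult[OF p] div_mod_less_of_less_mult[OF q]
  have "X_F n M $$ (p, q) = (\<Sum>i<n. \<Sum>j<n.
      if j = q div rdim M then if i = p div rdim M then
        lie_act n M (matrix_unit n j i) $$ (p mod rdim M, q mod rdim M) else 0 else 0)"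
  proof -
    have "X_F n M $$ (p, q) = (\<Sum>i<n. \<Sum>j<n.
        kron (matrix_unit n i j) (lie_act n M (matrix_unit n j i)) $$ (p, q))"
      using p q by (simp add: X_F_def)
    also have "\<dots> = (\<Sum>i<n. \<Sum>j<n.
      if j = q div rdim M then if i = p div rdim M then
        lie_act n M (matrix_unit n j i) $$ (p mod rdim M, q mod rdim M) else 0 else 0)"
    proof (intro sum.cong refl)
      fix i j
      show "kron (matrix_unit n i j) (lie_act n M (matrix_unit n j i)) $$ (p, q) =
        (if j = q div rdim M then if i = p div rdim M then
          lie_act n M (matrix_unit n j i) $$ (p mod rdim M, q mod rdim M) else 0 else 0)"
        unfolding kron_index[OF matrix_unit_carrier lie_act_carrier p q]
        using pq(1,3) by (simp add: matrix_unit_def)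
    qed
    finally show ?thesis .
  qed
  then show ?thesis
    using pq by simp
qed

text \<open>
  The map \<open>A\<close> is applied to each block, and it commutes with the action of every matrix unit.
\<close>

lemma X_F_natural:
  fixes M N :: "'a::alg_closed_field gl_rep"
  assumes M: "rational_rep n M" and N: "rational_rep n N" and A: "A \<in> gl_hom n M N"
  shows "X_F n N * F_map n A = F_map n A * X_F n M"
proof (rule eq_matI)
  let ?m = "rdim M" and ?m' = "rdim N"
  note dA = gl_hom_carrier[OF A]
  have dF: "F_map n A \<in> carrier_mat (n * ?m') (n * ?m)"
    unfolding F_map_def by (intro kron_carrier dA one_carrier_mat)
  fix p q assume "p < dim_row (F_map n A * X_F n M)" "q < dim_col (F_map n A * X_F n M)"
  then have p: "p < n * ?m'" and q: "q < n * ?m"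
    using dF by (auto simp: X_F_def)
  note pq = div_mod_less_of_less_mult[OF p] div_mod_less_of_less_mult[OF q]
  let ?i = "p div ?m'" and ?a = "p mod ?m'" and ?j = "q div ?m" and ?b = "q mod ?m"
  let ?L = "\<lambda>k. lie_act n N (matrix_unit n k ?i)" and ?L' = "\<lambda>k. lie_act n M (matrix_unit n ?j k)"
  let ?f = "\<lambda>k c. ?L k $$ (?a, c) * ((if k = ?j then 1 else 0) * A $$ (c, ?b))"
  let ?f' = "\<lambda>k c. (if k = ?i then 1 else 0) * A $$ (?a, c) * ?L' k $$ (c, ?b)"
  have "(X_F n N * F_map n A) $$ (p, q) = (\<Sum>k<n * ?m'. ?f (k div ?m') (k mod ?m'))"
    unfolding mult_mat_index[OF X_F_carrier dF p q]
    by (intro sum.cong)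
      (use p q pq in \<open>auto simp: F_map_def X_F_index kron_index[OF one_carrier_mat dA]
        div_mod_less_of_less_mult\<close>)
  also have "\<dots> = (\<Sum>k<n. if k = ?j then (?L k * A) $$ (?a, ?b) else 0)"
    unfolding sum_div_mod[of ?f]
    by (intro sum.cong) (auto simp: mult_mat_index[OF lie_act_carrier dA pq(2,4)] simp del: index_mult_mat)
  also have "\<dots> = (?L ?j * A) $$ (?a, ?b)"
    using pq(3) by simp
  also have "?L ?j * A = A * ?L' ?i"
    by (rule lie_act_intertwine[symmetric, OF M N dA])
      (use gl_hom_equivariant[OF A] in auto)
  also have "(A * ?L' ?i) $$ (?a, ?b) = (\<Sum>k<n. if k = ?i then (A * ?L' k) $$ (?a, ?b) else 0)"
    using pq(1) by simp
  also have "\<dots> = (\<Sum>k<n * ?m. ?f' (k div ?m) (k mod ?m))"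
    unfolding sum_div_mod[of ?f']
    by (intro sum.cong) (auto simp: mult_mat_index[OF dA lie_act_carrier pq(2,4)] simp del: index_mult_mat)
  also have "\<dots> = (F_map n A * X_F n M) $$ (p, q)"
    unfolding mult_mat_index[OF dF X_F_carrier p q]
    by (intro sum.cong)
      (use p q pq in \<open>auto simp: F_map_def X_F_index kron_index[OF one_carrier_mat dA]
        div_mod_less_of_less_mult\<close>)
  finally show "(X_F n N * F_map n A) $$ (p, q) = (F_map n A * X_F n M) $$ (p, q)" .
qed (auto simp: F_map_def X_F_def gl_hom_carrier[OF A, THEN carrier_matD(1)]
    gl_hom_carrier[OF A, THEN carrier_matD(2)])

text \<open>
  The block \<open>(i, j)\<close> of \<open>X (g \<otimes> g)\<close> is the sum of \<open>g\<^sub>k\<^sub>j E\<^sub>k\<^sub>i\<close> over \<open>k\<close>, followed on the right by the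
  action of \<open>g\<close>; by linearity of the Lie algebra action the sum acts as \<open>g E\<^sub>j\<^sub>i\<close>. Likewise the block
  of \<open>(g \<otimes> g) X\<close> is the action of \<open>g\<close> times that of \<open>E\<^sub>j\<^sub>i g\<close>. As \<open>g (E\<^sub>j\<^sub>i g) = (g E\<^sub>j\<^sub>i) g\<close>, the two
  matrices are conjugate by \<open>g\<close>, and their actions by the action of \<open>g\<close>.
\<close>

lemma X_F_gl_hom:
  fixes M :: "'a::alg_closed_field gl_rep"
  assumes M: "rational_rep n M"
  shows "X_F n M \<in> gl_hom n (F_obj n M) (F_obj n M)"
  unfolding gl_hom_def mem_Collect_eq F_obj_simps
proof (intro conjI ballI X_F_carrier)
  fix g :: "'a mat" assume g: "g \<in> GL n"
  let ?m = "rdim M" and ?R = "ract M g"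
  let ?K = "kron g ?R"
  note dg = GL_carrier[OF g] and dR = rational_rep_carrier[OF M g]
  have dK: "?K \<in> carrier_mat (n * ?m) (n * ?m)"
    by (intro kron_carrier dg dR)
  show "X_F n M * ?K = ?K * X_F n M"
  proof (rule eq_matI)
    fix p q assume "p < dim_row (?K * X_F n M)" "q < dim_col (?K * X_F n M)"
    then have p: "p < n * ?m" and q: "q < n * ?m"
      using dg dR by (auto simp: X_F_def)
    note pq = div_mod_less_of_less_mult[OF p] div_mod_less_of_less_mult[OF q]
    let ?i = "p div ?m" and ?a = "p mod ?m" and ?j = "q div ?m" and ?b = "q mod ?m"
    let ?E = "matrix_unit n ?j ?i"
    have dE: "?E \<in> carrier_mat n n"
      by simp
    let ?L = "\<lambda>k l. lie_act n M (matrix_unit n k l)"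
    let ?f = "\<lambda>k c. ?L k ?i $$ (?a, c) * (g $$ (k, ?j) * ?R $$ (c, ?b))"
    let ?f' = "\<lambda>k c. g $$ (?i, k) * ?R $$ (?a, c) * ?L ?j k $$ (c, ?b)"
    have gE: "(g * ?E) $$ (r, s) = (if s = ?i then g $$ (r, ?j) else 0)" if "r < n" "s < n" for r s
    proof -
      have "(g * ?E) $$ (r, s) = (\<Sum>k<n. if k = ?j then if s = ?i then g $$ (r, ?j) else 0 else 0)"
        unfolding mult_mat_index[OF dg dE that]
        by (intro sum.cong) (use that in \<open>auto simp: matrix_unit_def\<close>)
      then show ?thesis
        using pq(3) by simp
    qed
    have Eg: "(?E * g) $$ (r, s) = (if r = ?j then g $$ (?i, s) else 0)" if "r < n" "s < n" for r s
    proof -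
      have "(?E * g) $$ (r, s) = (\<Sum>k<n. if k = ?i then if r = ?j then g $$ (?i, s) else 0 else 0)"
        unfolding mult_mat_index[OF dE dg that]
        by (intro sum.cong) (use that in \<open>auto simp: matrix_unit_def\<close>)
      then show ?thesis
        using pq(1) by simp
    qed
    have LgE: "lie_act n M (g * ?E) $$ (?a, c) = (\<Sum>k<n. ?L k ?i $$ (?a, c) * g $$ (k, ?j))"
      if "c < ?m" for c
    proof -
      have "lie_act n M (g * ?E) $$ (?a, c) =
          (\<Sum>r<n. \<Sum>s<n. if s = ?i then ?L r ?i $$ (?a, c) * g $$ (r, ?j) else 0)"
        unfolding lie_act_linear[OF M pq(2) that mult_carrier_mat[OF dg dE]]
        by (intro sum.cong) (auto simp: gE simp del: index_mult_mat)
      then show ?thesis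
        using pq(1) by simp
    qed
    have LEg: "lie_act n M (?E * g) $$ (c, ?b) = (\<Sum>k<n. ?L ?j k $$ (c, ?b) * g $$ (?i, k))"
      if "c < ?m" for c
    proof -
      have "lie_act n M (?E * g) $$ (c, ?b) =
          (\<Sum>r<n. if r = ?j then \<Sum>s<n. ?L ?j s $$ (c, ?b) * g $$ (?i, s) else 0)"
        unfolding lie_act_linear[OF M that pq(4) mult_carrier_mat[OF dE dg]]
        by (intro sum.cong) (auto simp: Eg simp del: index_mult_mat)
      then show ?thesis
        using pq(3) by simp
    qed
    have "(X_F n M * ?K) $$ (p, q) = (\<Sum>k<n * ?m. ?f (k div ?m) (k mod ?m))"
      unfolding mult_mat_index[OF X_F_carrier dK p q]
      by (intro sum.cong) (use p q in \<open>auto simp: X_F_index kron_index[OF dg dR]\<close>)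
    also have "\<dots> = (\<Sum>c<?m. \<Sum>k<n. ?f k c)"
      unfolding sum_div_mod[of ?f] by (rule sum.swap)
    also have "\<dots> = (lie_act n M (g * ?E) * ?R) $$ (?a, ?b)"
      unfolding mult_mat_index[OF lie_act_carrier dR pq(2,4)]
      by (intro sum.cong) (auto simp: LgE sum_distrib_left sum_distrib_right ac_simps)
    also have "lie_act n M (g * ?E) * ?R = ?R * lie_act n M (?E * g)"
    proof (rule lie_act_intertwine[symmetric, OF M M dR])
      fix t
      let ?x = "1\<^sub>m n + t \<cdot>\<^sub>m (?E * g)" and ?y = "1\<^sub>m n + t \<cdot>\<^sub>m (g * ?E)"
      assume xy: "?x \<in> GL n" "?y \<in> GL n"
      have "g * ?x = g + t \<cdot>\<^sub>m (g * (?E * g))"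
        using dg mult_add_distrib_mat[OF dg one_carrier_mat smult_carrier_mat[OF mult_carrier_mat[OF dE dg]]]
          mult_smult_distrib[OF dg mult_carrier_mat[OF dE dg]] by simp
      also have "\<dots> = g + t \<cdot>\<^sub>m (g * ?E * g)"
        using assoc_mult_mat[OF dg dE dg] by simp
      also have "\<dots> = ?y * g"
        using dg add_mult_distrib_mat[OF one_carrier_mat smult_carrier_mat[OF mult_carrier_mat[OF dg dE]] dg]
          mult_smult_assoc_mat[OF mult_carrier_mat[OF dg dE] dg] by simp
      finally show "?R * ract M ?x = ract M ?y * ?R"
        using rational_rep_mult[OF M g xy(1)] rational_rep_mult[OF M xy(2) g] by simp
    qed (use mult_carrier_mat[OF dE dg] mult_carrier_mat[OF dg dE] in simp_all)
    also have "(?R * lie_act n M (?E * g)) $$ (?a, ?b) = (\<Sum>c<?m. \<Sum>k<n. ?f' k c)"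
      unfolding mult_mat_index[OF dR lie_act_carrier pq(2,4)]
      by (intro sum.cong) (auto simp: LEg sum_distrib_left ac_simps)
    also have "\<dots> = (\<Sum>k<n * ?m. ?f' (k div ?m) (k mod ?m))"
      unfolding sum_div_mod[of ?f'] by (rule sum.swap)
    also have "\<dots> = (?K * X_F n M) $$ (p, q)"
      unfolding mult_mat_index[OF dK X_F_carrier p q]
      by (intro sum.cong) (use p q in \<open>auto simp: X_F_index kron_index[OF dg dR]\<close>)
    finally show "(X_F n M * ?K) $$ (p, q) = (?K * X_F n M) $$ (p, q)" .
  qed (use dg dR in \<open>auto simp: X_F_def\<close>)
qed

lemma T_F_gl_hom:
  assumes M: "rational_rep n M"
  shows "T_F n M \<in> gl_hom n (F_obj n (F_obj n M)) (F_obj n (F_obj n M))"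
  unfolding gl_hom_def mem_Collect_eq F_obj_simps
proof (intro conjI ballI)
  let ?P = "place_perm n 2 (Transposition.transpose 1 2)"
  have perm: "Transposition.transpose 1 2 permutes {1..2::nat}"
    by (rule permutes_swap_id) auto
  show "T_F n M \<in> carrier_mat (n * (n * rdim M)) (n * (n * rdim M))"
    using kron_carrier[OF place_perm_carrier one_carrier_mat, of n 2 _ "rdim M"]
    by (simp add: T_F_def power2_eq_square ac_simps)
  fix g :: "'a mat" assume g: "g \<in> GL n"
  note dg = GL_carrier[OF g] and dR = rational_rep_carrier[OF M g]
  let ?G = "ract (tensor_power n 2) g"
  note dG = ract_tensor_power_carrier[OF dg, of 2]
  have "kron g (kron g (ract M g)) = kron ?G (ract M g)"
    by (simp add: kron_assoc kron_one_right numeral_2_eq_2 del: One_nat_def)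
  then show "T_F n M * kron g (kron g (ract M g)) = kron g (kron g (ract M g)) * T_F n M"
    using dR gl_hom_equivariant[OF place_perm_gl_hom[OF perm, of n] g]
    by (simp add: T_F_def kron_mult_kron[OF place_perm_carrier one_carrier_mat dG dR]
        kron_mult_kron[OF dG dR place_perm_carrier one_carrier_mat])
qed

lemma T_F_natural:
  assumes A: "A \<in> gl_hom n M N"
  shows "T_F n N * F_map n (F_map n A) = F_map n (F_map n A) * T_F n M"
proof -
  note dA = gl_hom_carrier[OF A]
  have "F_map n (F_map n A) = kron (1\<^sub>m (n\<^sup>2)) A"
    by (simp add: F_map_def kron_assoc kron_one_one power2_eq_square)
  then show ?thesis
    using dA by (simp add: T_F_def kron_mult_kron[OF place_perm_carrier one_carrier_mat one_carrier_mat dA]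
        kron_mult_kron[OF one_carrier_mat dA place_perm_carrier one_carrier_mat])
qed

text \<open>
  The reason for Jucys-Murphy elements to appear. By the Leibniz rule \<open>gl\<^sub>n\<close> acts on \<open>V\<^bsup>\<otimes>d\<^esup>\<close> as the
  sum over \<open>k\<close> of its actions in place \<open>k\<close>, and the sum of all \<open>E\<^sub>i\<^sub>j \<otimes> E\<^sub>j\<^sub>i\<close> exchanges the factors
  of \<open>V \<otimes> V\<close>. So \<open>X\<close> on \<open>V \<otimes> V\<^bsup>\<otimes>d\<^esup>\<close> is the sum of the exchanges of the new first place with the
  places \<open>k + 1\<close>.
\<close>

lemma X_F_tensor_power:
  assumes p: "p < n ^ Suc d" and q: "q < n ^ Suc d"
  shows "X_F n (tensor_power n d) $$ (p, q) =
    (\<Sum>k=1..d. place_perm n (Suc d) (Transposition.transpose 1 (Suc k)) $$ (p, q)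
      :: 'a::alg_closed_field)"
proof -
  have p': "p < n * n ^ d" and q': "q < n * n ^ d"
    using p q by auto
  note pq = div_mod_less_of_less_mult[OF p'] div_mod_less_of_less_mult[OF q']
  let ?i = "p div n ^ d" and ?a = "p mod n ^ d" and ?j = "q div n ^ d" and ?b = "q mod n ^ d"
  let ?x = "matrix_unit n ?j ?i :: 'a mat"
  let ?at = "tensor_place n d ?a" and ?bt = "tensor_place n d ?b"
  have at: "?at k < n" "?bt k < n" if "k \<in> {1..d}" for k
    using tensor_place_less power_pos_of_less[OF pq(2) that] by blast+
  let ?\<delta> = "\<lambda>k. if ?at k = ?bt k then 1 else 0 :: 'a"
    and ?\<epsilon> = "\<lambda>k. if ?at k = ?j \<and> ?bt k = ?i then 1 else 0 :: 'a"
  have "ract (tensor_power n d) (1\<^sub>m n + t \<cdot>\<^sub>m ?x) $$ (?a, ?b) = (\<Prod>k=1..d. ?\<delta> k + t * ?\<epsilon> k)" for t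
  proof -
    have d: "1\<^sub>m n + t \<cdot>\<^sub>m ?x \<in> carrier_mat n n"
      by simp
    show ?thesis
      unfolding ract_tensor_power_index[OF d pq(2,4)]
      by (intro prod.cong) (use at in \<open>auto simp: matrix_unit_def\<close>)
  qed
  then have "lie_act n (tensor_power n d) ?x $$ (?a, ?b) =
      (\<Sum>k=1..d. ?\<epsilon> k * (\<Prod>l\<in>{1..d} - {k}. ?\<delta> l))"
    using pq by (simp add: lie_act_def rat_deriv0_eqI[OF has_rat_deriv0_prod_linear])
  also have "\<dots> = (\<Sum>k=1..d. place_perm n (Suc d) (Transposition.transpose 1 (Suc k)) $$ (p, q))"
  proof (rule sum.cong)
    fix k assume k: "k \<in> {1..d}"
    have prod: "(\<Prod>l\<in>{1..d} - {k}. ?\<delta> l) = (if \<forall>l\<in>{1..d} - {k}. ?at l = ?bt l then 1 else 0)"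
    proof (cases "\<forall>l\<in>{1..d} - {k}. ?at l = ?bt l")
      case False
      then have "\<exists>l\<in>{1..d} - {k}. ?\<delta> l = 0"
        by auto
      then show ?thesis
        using False by (simp add: prod_zero)
    qed auto
    let ?pt = "tensor_place n (Suc d) p" and ?qt = "tensor_place n (Suc d) q"
    have "(\<forall>l\<in>{1..Suc d}. ?pt (Transposition.transpose 1 (Suc k) l) = ?qt l) \<longleftrightarrow>
        ?pt (Suc k) = ?qt (Suc 0) \<and> (\<forall>l\<in>{1..d}. ?pt (if l = k then Suc 0 else Suc l) = ?qt (Suc l))"
      unfolding ball_atLeast1_Suc by (auto simp: Transposition.transpose_def)
    also have "\<dots> \<longleftrightarrow> ?at k = ?j \<and> ?bt k = ?i \<and> (\<forall>l\<in>{1..d} - {k}. ?at l = ?bt l)"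
      using k p q by (auto simp: tensor_place_first tensor_place_Suc split: if_splits)
    finally show "?\<epsilon> k * (\<Prod>l\<in>{1..d} - {k}. ?\<delta> l) =
        place_perm n (Suc d) (Transposition.transpose 1 (Suc k)) $$ (p, q)"
      unfolding prod place_perm_index[OF p q] by simp
  qed simp
  finally show ?thesis
    using X_F_index[of p n "tensor_power n d :: 'a gl_rep" q] p' q' by simp
qed

section \<open>The endomorphisms \<open>X\<close> and \<open>T\<close> of \<open>E\<close>\<close>

text \<open>
  The Yoneda lemma for the functor \<open>Hom(G -, M)\<close>, represented by \<open>R\<close> through \<open>\<Phi>\<close>: precomposition with
  a natural endomorphism \<open>Z\<close> of \<open>G\<close> is postcomposition with a unique endomorphism of \<open>R\<close>, namely the
  image of \<open>\<epsilon> Z\<close> for the counit \<open>\<epsilon>\<close>. It is used with \<open>G = F\<close> and \<open>Z = X\<close>, and with \<open>G = F\<^sup>2\<close> and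
  \<open>Z = T\<close>, to show that the descriptions defining \<^const>\<open>X_E\<close> and \<^const>\<open>T_E\<close> describe something.
\<close>

lemma yoneda_endomorphism:
  fixes \<Phi> :: "'a::field gl_rep \<Rightarrow> 'a mat \<Rightarrow> 'a mat"
  assumes R: "R \<in> Rep n d" and M: "rational_rep n M"
    and G: "\<And>N. N \<in> Rep n d \<Longrightarrow> rational_rep n (G N)"
    and Gm: "\<And>N N' \<nu>. N \<in> Rep n d \<Longrightarrow> N' \<in> Rep n d \<Longrightarrow> \<nu> \<in> gl_hom n N' N \<Longrightarrow>
      Gm \<nu> \<in> gl_hom n (G N') (G N)"
    and bij: "\<And>N. N \<in> Rep n d \<Longrightarrow> bij_betw (\<Phi> N) (gl_hom n (G N) M) (gl_hom n N R)"
    and nat: "\<And>N N' \<nu> \<phi>. N \<in> Rep n d \<Longrightarrow> N' \<in> Rep n d \<Longrightarrow> \<nu> \<in> gl_hom n N' N \<Longrightarrow>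
      \<phi> \<in> gl_hom n (G N) M \<Longrightarrow> \<Phi> N' (\<phi> * Gm \<nu>) = \<Phi> N \<phi> * \<nu>"
    and Z: "\<And>N. N \<in> Rep n d \<Longrightarrow> Z N \<in> gl_hom n (G N) (G N)"
    and Znat: "\<And>N N' \<nu>. N \<in> Rep n d \<Longrightarrow> N' \<in> Rep n d \<Longrightarrow> \<nu> \<in> gl_hom n N' N \<Longrightarrow>
      Z N * Gm \<nu> = Gm \<nu> * Z N'"
  defines "\<chi> \<equiv> THE \<chi>. \<chi> \<in> gl_hom n R R \<and>
    (\<forall>N\<in>Rep n d. \<forall>\<phi>\<in>gl_hom n (G N) M. \<Phi> N (\<phi> * Z N) = \<chi> * \<Phi> N \<phi>)"
  assumes N: "N \<in> Rep n d" and \<phi>: "\<phi> \<in> gl_hom n (G N) M"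
  shows "\<Phi> N (\<phi> * Z N) = \<chi> * \<Phi> N \<phi>"
proof -
  let ?Q = "\<lambda>\<chi>. \<chi> \<in> gl_hom n R R \<and>
    (\<forall>N\<in>Rep n d. \<forall>\<phi>\<in>gl_hom n (G N) M. \<Phi> N (\<phi> * Z N) = \<chi> * \<Phi> N \<phi>)"
  have "1\<^sub>m (rdim R) \<in> \<Phi> R ` gl_hom n (G R) M"
    using gl_hom_one[OF Rep_rational[OF R]] bij_betw_imp_surj_on[OF bij[OF R]] by simp
  then obtain \<epsilon> where \<epsilon>: "\<epsilon> \<in> gl_hom n (G R) M" "\<Phi> R \<epsilon> = 1\<^sub>m (rdim R)"
    by (metis imageE)
  have \<epsilon>Z: "\<epsilon> * Z R \<in> gl_hom n (G R) M"
    by (rule gl_hom_mult[OF G[OF R] G[OF R] M \<epsilon>(1) Z[OF R]])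
  have "?Q (\<Phi> R (\<epsilon> * Z R))"
  proof (intro conjI ballI)
    show "\<Phi> R (\<epsilon> * Z R) \<in> gl_hom n R R"
      using bij_betwE[OF bij[OF R]] \<epsilon>Z by blast
    fix N \<phi> assume N: "N \<in> Rep n d" and \<phi>: "\<phi> \<in> gl_hom n (G N) M"
    have \<psi>: "\<Phi> N \<phi> \<in> gl_hom n N R"
      using bij_betwE[OF bij[OF N]] \<phi> by blast
    note g = Gm[OF R N \<psi>]
    have "\<Phi> N (\<epsilon> * Gm (\<Phi> N \<phi>)) = \<Phi> N \<phi>"
      using nat[OF R N \<psi> \<epsilon>(1)] \<epsilon>(2) gl_hom_carrier[OF \<psi>] by simp
    then have \<phi>_eq: "\<phi> = \<epsilon> * Gm (\<Phi> N \<phi>)"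
      using bij_betw_imp_inj_on[OF bij[OF N]] gl_hom_mult[OF G[OF N] G[OF R] M \<epsilon>(1) g] \<phi>
      by (metis inj_onD)
    have "\<phi> * Z N = \<epsilon> * Gm (\<Phi> N \<phi>) * Z N"
      using \<phi>_eq by simp
    also have "\<dots> = \<epsilon> * (Gm (\<Phi> N \<phi>) * Z N)"
      by (rule assoc_mult_mat[OF gl_hom_carrier[OF \<epsilon>(1)] gl_hom_carrier[OF g] gl_hom_carrier[OF Z[OF N]]])
    also have "\<dots> = \<epsilon> * (Z R * Gm (\<Phi> N \<phi>))"
      by (simp only: Znat[OF R N \<psi>])
    also have "\<dots> = \<epsilon> * Z R * Gm (\<Phi> N \<phi>)"
      by (rule assoc_mult_mat[symmetric, OF gl_hom_carrier[OF \<epsilon>(1)] gl_hom_carrier[OF Z[OF R]] gl_hom_carrier[OF g]])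
    finally show "\<Phi> N (\<phi> * Z N) = \<Phi> R (\<epsilon> * Z R) * \<Phi> N \<phi>"
      using nat[OF R N \<psi> \<epsilon>Z] by simp
  qed
  moreover have "\<chi>' = \<Phi> R (\<epsilon> * Z R)" if "?Q \<chi>'" for \<chi>'
  proof -
    have "\<Phi> R (\<epsilon> * Z R) = \<chi>' * \<Phi> R \<epsilon>"
      using that R \<epsilon>(1) by blast
    then show ?thesis
      using that \<epsilon>(2) gl_hom_carrier[of \<chi>' n R R] by simp
  qed
  ultimately have "?Q \<chi>"
    unfolding \<chi>_def by (rule theI)
  then show ?thesis
    using N \<phi> by blast
qed

context
  fixes n :: nat and A :: "'a::alg_closed_field adjunction"
  assumes A: "right_adjoint_F n A"
begin

lemma E_obj_Rep: "Suc d \<le> n \<Longrightarrow> M \<in> Rep n (Suc d) \<Longrightarrow> E_obj A d M \<in> Rep n d"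
  using A[unfolded right_adjoint_F_def, THEN spec, of d] by simp

lemma adj_bij:
  "Suc d \<le> n \<Longrightarrow> N \<in> Rep n d \<Longrightarrow> M \<in> Rep n (Suc d) \<Longrightarrow>
    bij_betw (adj A d N M) (gl_hom n (F_obj n N) M) (gl_hom n N (E_obj A d M))"
  using A unfolding right_adjoint_F_def by blast

lemma adj_natural:
  "Suc d \<le> n \<Longrightarrow> N \<in> Rep n d \<Longrightarrow> N' \<in> Rep n d \<Longrightarrow> M \<in> Rep n (Suc d) \<Longrightarrow>
    \<nu> \<in> gl_hom n N' N \<Longrightarrow> \<phi> \<in> gl_hom n (F_obj n N) M \<Longrightarrow>
    adj A d N' M (\<phi> * F_map n \<nu>) = adj A d N M \<phi> * \<nu>"
  using A unfolding right_adjoint_F_def by blast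

lemma adj_gl_hom:
  "Suc d \<le> n \<Longrightarrow> N \<in> Rep n d \<Longrightarrow> M \<in> Rep n (Suc d) \<Longrightarrow> \<phi> \<in> gl_hom n (F_obj n N) M \<Longrightarrow>
    adj A d N M \<phi> \<in> gl_hom n N (E_obj A d M)"
  using adj_bij bij_betwE by blast

lemma adj_X_F:
  assumes d: "Suc d \<le> n" and M: "M \<in> Rep n (Suc d)" and N: "N \<in> Rep n d"
    and \<phi>: "\<phi> \<in> gl_hom n (F_obj n N) M"
  shows "adj A d N M (\<phi> * X_F n N) = X_E n A d M * adj A d N M \<phi>"
  unfolding X_E_def
  by (rule yoneda_endomorphism[where Gm = "F_map n" and \<Phi> = "\<lambda>N. adj A d N M" and G = "F_obj n"
        and Z = "X_F n", OF E_obj_Rep[OF d M] Rep_rational[OF M] _ _ adj_bij[OF d _ M] _ _ _ N \<phi>])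
    (blast intro: F_obj_rational Rep_rational gl_hom_F_map X_F_gl_hom X_F_natural adj_natural[OF d _ _ M])+

lemma adj2_bij:
  assumes d: "Suc (Suc d) \<le> n" and N: "N \<in> Rep n d" and M: "M \<in> Rep n (Suc (Suc d))"
  shows "bij_betw (adj2 n A d N M) (gl_hom n (F_obj n (F_obj n N)) M) (gl_hom n N (E2_obj A d M))"
proof -
  have "adj2 n A d N M = adj A d N (E_obj A (Suc d) M) \<circ> adj A (Suc d) (F_obj n N) M"
    by (simp add: adj2_def fun_eq_iff)
  then show ?thesis
    unfolding E2_obj_def
    using bij_betw_trans[OF adj_bij[OF d F_obj_Rep[OF N] M] adj_bij[OF _ N E_obj_Rep[OF d M]]] d
    by simp
qed

lemma adj2_natural:
  assumes d: "Suc (Suc d) \<le> n" and N: "N \<in> Rep n d" "N' \<in> Rep n d" and M: "M \<in> Rep n (Suc (Suc d))"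
    and \<nu>: "\<nu> \<in> gl_hom n N' N" and \<phi>: "\<phi> \<in> gl_hom n (F_obj n (F_obj n N)) M"
  shows "adj2 n A d N' M (\<phi> * F_map n (F_map n \<nu>)) = adj2 n A d N M \<phi> * \<nu>"
  unfolding adj2_def
  using adj_natural[OF d F_obj_Rep[OF N(1)] F_obj_Rep[OF N(2)] M
      gl_hom_F_map[OF Rep_rational[OF N(2)] Rep_rational[OF N(1)] \<nu>] \<phi>]
    adj_natural[OF _ N E_obj_Rep[OF d M] \<nu> adj_gl_hom[OF d F_obj_Rep[OF N(1)] M \<phi>]] d
  by simp

lemma adj2_T_F:
  assumes d: "Suc (Suc d) \<le> n" and M: "M \<in> Rep n (Suc (Suc d))" and N: "N \<in> Rep n d"
    and \<phi>: "\<phi> \<in> gl_hom n (F_obj n (F_obj n N)) M"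
  shows "adj2 n A d N M (\<phi> * T_F n N) = T_E n A d M * adj2 n A d N M \<phi>"
proof -
  have R: "E2_obj A d M \<in> Rep n d"
    unfolding E2_obj_def using d by (intro E_obj_Rep M) auto
  show ?thesis
    unfolding T_E_def
    by (rule yoneda_endomorphism[where Gm = "\<lambda>\<nu>. F_map n (F_map n \<nu>)" and \<Phi> = "\<lambda>N. adj2 n A d N M"
        and G = "\<lambda>N. F_obj n (F_obj n N)" and Z = "T_F n",
        OF R Rep_rational[OF M] _ _ adj2_bij[OF d _ M] _ _ _ N \<phi>])
      (blast intro: F_obj_rational Rep_rational gl_hom_F_map T_F_gl_hom T_F_natural
        adj2_natural[OF d _ _ M])+
qed

lemma schur_E_iso_adj:
  assumes "Suc d \<le> n" "M \<in> Rep n (Suc d)" "\<phi> \<in> gl_hom n (F_obj n (tensor_power n d)) M"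
  shows "schur_E_iso n A d M (adj A d (tensor_power n d) M \<phi>) =
    \<phi> * place_perm n (Suc d) (last_to_first (Suc d))"
  unfolding schur_E_iso_def
  using bij_betw_imp_inj_on[OF adj_bij[OF assms(1) tensor_power_Rep assms(2)]] assms(3)
  by (simp add: inv_into_f_f)

end

section \<open>Compatibility with \<open>X\<close>\<close>

lemma permutes_of_inj_on:
  assumes "finite S" "inj_on p S" "p ` S \<subseteq> S" "\<And>x. x \<notin> S \<Longrightarrow> p x = x"
  shows "p permutes S"
  using assms by (intro bij_imp_permutes) (auto simp: bij_betw_def endo_inj_surj)

lemma last_to_first_permutes: "last_to_first (Suc d) permutes {1..Suc d}"
  by (rule permutes_of_inj_on) (auto simp: last_to_first_def inj_on_def)

lemma last_to_first_conj:
  assumes "i \<in> {1..d}"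
  shows "last_to_first (Suc d) (Transposition.transpose i (Suc d) k) =
    Transposition.transpose 1 (Suc i) (last_to_first (Suc d) k)"
  using assms by (auto simp: last_to_first_def Transposition.transpose_def)

lemma transpose_first_permutes:
  "i \<in> {1..d} \<Longrightarrow> Transposition.transpose 1 (Suc i) permutes {1..Suc d}"
  by (rule permutes_swap_id) auto

lemma place_perm_last_to_first_conj:
  assumes i: "i \<in> {1..d}"
  shows "place_perm n (Suc d) (last_to_first (Suc d)) * place_perm n (Suc d) (Transposition.transpose i (Suc d)) =
    place_perm n (Suc d) (Transposition.transpose 1 (Suc i)) *
      (place_perm n (Suc d) (last_to_first (Suc d)) :: 'a::comm_semiring_1 mat)"
proof -
  have "Transposition.transpose i (Suc d) permutes {1..Suc d}"
    using i by (intro permutes_swap_id) auto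
  then show ?thesis
    by (simp only: place_perm_mult last_to_first_permutes transpose_first_permutes[OF i])
      (simp add: comp_def last_to_first_conj[OF i])
qed

lemma gl_hom_add:
  assumes "rational_rep n M" "rational_rep n N" and A: "A \<in> gl_hom n M N" and B: "B \<in> gl_hom n M N"
  shows "A + B \<in> gl_hom n M N"
  unfolding gl_hom_def mem_Collect_eq
proof (intro conjI ballI)
  note dA = gl_hom_carrier[OF A] and dB = gl_hom_carrier[OF B]
  show "A + B \<in> carrier_mat (rdim N) (rdim M)"
    using dB by simp
  fix g :: "'a mat" assume g: "g \<in> GL n"
  note d = assms(1,2)[THEN rational_rep_carrier, OF g]
  show "(A + B) * ract M g = ract N g * (A + B)"
    using gl_hom_equivariant[OF A g] gl_hom_equivariant[OF B g]
    by (simp add: add_mult_distrib_mat[OF dA dB d(1)] mult_add_distrib_mat[OF d(2) dA dB])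
qed

lemma gl_hom_zero:
  fixes M N :: "'a::field gl_rep"
  assumes "rational_rep n M" "rational_rep n N"
  shows "0\<^sub>m (rdim N) (rdim M) \<in> gl_hom n M N"
  unfolding gl_hom_def mem_Collect_eq
proof (intro conjI ballI zero_carrier_mat)
  fix g :: "'a mat" assume g: "g \<in> GL n"
  show "0\<^sub>m (rdim N) (rdim M) * ract M g = ract N g * 0\<^sub>m (rdim N) (rdim M)"
    using left_mult_zero_mat[OF rational_rep_carrier[OF assms(1) g]]
      right_mult_zero_mat[OF rational_rep_carrier[OF assms(2) g]] by simp
qed

text \<open>
  The sum that defines \<^const>\<open>X_Res\<close> is a \<^const>\<open>finsum\<close>, which has its expected properties only in
  such a structure.
\<close>

lemma abelian_monoid_schur_obj:
  assumes M: "M \<in> Rep n d'"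
  shows "abelian_monoid (schur_obj n d (M :: 'a::alg_closed_field gl_rep))"
proof -
  note rat = Rep_rational[OF tensor_power_Rep, of n d] Rep_rational[OF M]
  have car: "\<phi> \<in> gl_hom n (tensor_power n d) M \<Longrightarrow> \<phi> \<in> carrier_mat (rdim M) (n ^ d)" for \<phi>
    using gl_hom_carrier by force
  show ?thesis
    by (rule abelian_monoidI)
      (use gl_hom_add[OF rat] gl_hom_zero[OF rat] car in
        \<open>auto simp: schur_obj_def intro: assoc_add_mat comm_add_mat\<close>)
qed

lemma finsum_schur_obj:
  fixes M :: "'a::alg_closed_field gl_rep"
  assumes M: "M \<in> Rep n d'" and \<phi>: "\<phi> \<in> gl_hom n (tensor_power n d) M" and "finite I"
    and B: "\<And>i. i \<in> I \<Longrightarrow> B i \<in> gl_hom n (tensor_power n d) (tensor_power n d)"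
  shows "(\<Oplus>\<^bsub>schur_obj n d M\<^esub>i\<in>I. \<phi> * B i) = \<phi> * mat (n ^ d) (n ^ d) (\<lambda>p. \<Sum>i\<in>I. B i $$ p)"
  using \<open>finite I\<close> B
proof (induction I rule: finite_induct)
  interpret abelian_monoid "schur_obj n d M"
    by (rule abelian_monoid_schur_obj[OF M])
  have d\<phi>: "\<phi> \<in> carrier_mat (rdim M) (n ^ d)"
    using gl_hom_carrier[OF \<phi>] by simp
  note rat = Rep_rational[OF tensor_power_Rep, of n d] Rep_rational[OF M]
  have closed: "\<phi> * b \<in> carrier (schur_obj n d M)"
    if "b \<in> gl_hom n (tensor_power n d) (tensor_power n d)" for b
    using gl_hom_mult[OF rat(1,1,2) \<phi> that] by (simp add: schur_obj_def)
  {
    case empty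
    have "mat (n ^ d) (n ^ d) (\<lambda>p. 0) = (0\<^sub>m (n ^ d) (n ^ d) :: 'a mat)"
      by (intro eq_matI) auto
    moreover have "\<zero>\<^bsub>schur_obj n d M\<^esub> = 0\<^sub>m (rdim M) (n ^ d)"
      by (simp add: schur_obj_def)
    ultimately show ?case
      using d\<phi> by simp
  next
    case (insert i I)
    let ?S = "mat (n ^ d) (n ^ d) (\<lambda>p. \<Sum>i\<in>I. B i $$ p)"
    have dB: "B i \<in> carrier_mat (n ^ d) (n ^ d)"
      using gl_hom_carrier[OF insert.prems[of i]] by simp
    have "(\<Oplus>\<^bsub>schur_obj n d M\<^esub>i\<in>insert i I. \<phi> * B i) = \<phi> * B i + \<phi> * ?S"
      using insert.hyps insert.prems closed insert.IH
      by (subst finsum_insert) (auto simp: schur_obj_def)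
    also have "\<dots> = \<phi> * (B i + ?S)"
      by (rule mult_add_distrib_mat[symmetric, OF d\<phi> dB]) simp
    also have "B i + ?S = mat (n ^ d) (n ^ d) (\<lambda>p. \<Sum>i\<in>insert i I. B i $$ p)"
      using insert.hyps dB by (intro eq_matI) auto
    finally show ?case .
  }
qed

lemma X_F_last_to_first:
  "X_F n (tensor_power n d) * place_perm n (Suc d) (last_to_first (Suc d)) =
    mat (n ^ Suc d) (n ^ Suc d) (\<lambda>p. \<Sum>i=1..d.
      (place_perm n (Suc d) (Transposition.transpose 1 (Suc i)) *
       place_perm n (Suc d) (last_to_first (Suc d)) :: 'a::alg_closed_field mat) $$ p)"
  (is "?X * ?L = ?S")
proof (rule eq_matI)
  have dX: "?X \<in> carrier_mat (n ^ Suc d) (n ^ Suc d)"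
    using X_F_carrier[of n "tensor_power n d :: 'a gl_rep"] by simp
  fix p q assume "p < dim_row ?S" "q < dim_col ?S"
  then have p: "p < n ^ Suc d" and q: "q < n ^ Suc d"
    by auto
  have "\<forall>k\<in>{1..Suc d}. tensor_place n (Suc d) q (Hilbert_Choice.inv (last_to_first (Suc d)) k) < n"
    using tensor_place_less power_pos_of_less[OF q] by blast
  from tensor_place_surj[OF this] obtain c where c: "c < n ^ Suc d"
    "\<forall>k\<in>{1..Suc d}. tensor_place n (Suc d) c k =
      tensor_place n (Suc d) q (Hilbert_Choice.inv (last_to_first (Suc d)) k)"
    by blast
  have c': "\<forall>k\<in>{1..Suc d}. tensor_place n (Suc d) c (last_to_first (Suc d) k) = tensor_place n (Suc d) q k"
    using c(2) permutes_in_image[OF last_to_first_permutes] permutes_inverses[OF last_to_first_permutes]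
    by metis
  have "(Y * ?L) $$ (p, q) = Y $$ (p, c)" if "Y \<in> carrier_mat (n ^ Suc d) (n ^ Suc d)" for Y :: "'a mat"
    by (rule mult_place_perm_index[OF that p q c(1) last_to_first_permutes c'])
  then show "(?X * ?L) $$ (p, q) = ?S $$ (p, q)"
    using dX p q c(1) by (simp add: X_F_tensor_power del: index_mult_mat power_Suc)
qed (use X_F_carrier[of n "tensor_power n d :: 'a gl_rep"] in auto)

text \<open>
  Write \<open>\<psi>\<close> as the adjunct of \<open>\<phi> : F(V\<^bsup>\<otimes>d\<^esup>) \<rightarrow> M\<close>. Then \<open>X\<close> on \<open>E\<close> replaces \<open>\<phi>\<close> by \<open>\<phi> X\<close>, a sum of
  \<open>\<phi> (1 i+1)\<close>, and moving the last place to the front turns \<open>(1 i+1)\<close> into \<open>(i d+1)\<close>.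
\<close>

lemma schur_E_iso_X:
  fixes A :: "'a::alg_closed_field adjunction"
  assumes A: "right_adjoint_F n A" and d: "Suc d \<le> n" and M: "M \<in> Rep n (Suc d)"
    and \<psi>: "\<psi> \<in> carrier (schur_obj n d (E_obj A d M))"
  shows "schur_E_iso n A d M (schur_map (X_E n A d M) \<psi>) =
    X_Res (Suc d) (schur_obj n (Suc d) M) (schur_E_iso n A d M \<psi>)"
proof -
  let ?V = "tensor_power n d :: 'a gl_rep" and ?V' = "tensor_power n (Suc d) :: 'a gl_rep"
  let ?L = "place_perm n (Suc d) (last_to_first (Suc d)) :: 'a mat"
  let ?P = "\<lambda>\<sigma>. place_perm n (Suc d) \<sigma> :: 'a mat"
  note V = tensor_power_Rep[of n d, where 'a = 'a] and rat = Rep_rational[OF tensor_power_Rep]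
  obtain \<phi> where \<phi>: "\<phi> \<in> gl_hom n (F_obj n ?V) M" and \<psi>_eq: "\<psi> = adj A d ?V M \<phi>"
    using \<psi> bij_betw_imp_surj_on[OF adj_bij[OF A d V M]] by (auto simp: schur_obj_def)
  have \<phi>': "\<phi> \<in> gl_hom n ?V' M"
    using \<phi> by simp
  have X: "X_F n ?V \<in> gl_hom n ?V' ?V'"
    using X_F_gl_hom[OF rat] by simp
  have L: "?L \<in> gl_hom n ?V' ?V'"
    by (rule place_perm_gl_hom[OF last_to_first_permutes])
  have T: "?P (Transposition.transpose 1 (Suc i)) \<in> gl_hom n ?V' ?V'" if "i \<in> {1..d}" for i
    by (rule place_perm_gl_hom[OF transpose_first_permutes[OF that]])
  have d\<phi>: "\<phi> \<in> carrier_mat (rdim M) (n ^ Suc d)"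
    using gl_hom_carrier[OF \<phi>'] by simp
  have dX: "X_F n ?V \<in> carrier_mat (n ^ Suc d) (n ^ Suc d)"
    using gl_hom_carrier[OF X] by simp
  have \<phi>X: "\<phi> * X_F n ?V \<in> gl_hom n (F_obj n ?V) M"
    using gl_hom_mult[OF rat rat Rep_rational[OF M] \<phi>' X] by simp
  have "schur_E_iso n A d M (schur_map (X_E n A d M) \<psi>) = schur_E_iso n A d M (adj A d ?V M (\<phi> * X_F n ?V))"
    by (simp add: schur_map_def \<psi>_eq adj_X_F[OF A d M V \<phi>])
  also have "\<dots> = \<phi> * X_F n ?V * ?L"
    by (rule schur_E_iso_adj[OF A d M \<phi>X])
  also have "\<dots> = \<phi> * (X_F n ?V * ?L)"
    by (rule assoc_mult_mat[OF d\<phi> dX place_perm_carrier])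
  also have "\<dots> = (\<Oplus>\<^bsub>schur_obj n (Suc d) M\<^esub>i\<in>{1..d}. \<phi> * (?P (Transposition.transpose 1 (Suc i)) * ?L))"
    unfolding X_F_last_to_first
    by (rule finsum_schur_obj[symmetric, OF M \<phi>' finite_atLeastAtMost gl_hom_mult[OF rat rat rat T L]])
  also have "\<dots> = (\<Oplus>\<^bsub>schur_obj n (Suc d) M\<^esub>i\<in>{1..d}. \<phi> * ?L * ?P (Transposition.transpose i (Suc d)))"
  proof (rule abelian_monoid.finsum_cong'[OF abelian_monoid_schur_obj[OF M]])
    show "(\<lambda>i. \<phi> * ?L * ?P (Transposition.transpose i (Suc d))) \<in> {1..d} \<rightarrow> carrier (schur_obj n (Suc d) M)"
    proof
      fix i assume i: "i \<in> {1..d}"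
      then have "Transposition.transpose i (Suc d) permutes {1..Suc d}"
        by (intro permutes_swap_id) auto
      from gl_hom_mult[OF rat rat Rep_rational[OF M]
          gl_hom_mult[OF rat rat Rep_rational[OF M] \<phi>' L] place_perm_gl_hom[OF this]]
      show "\<phi> * ?L * ?P (Transposition.transpose i (Suc d)) \<in> carrier (schur_obj n (Suc d) M)"
        by (simp add: schur_obj_def)
    qed
    fix i assume i: "i \<in> {1..d}"
    show "\<phi> * (?P (Transposition.transpose 1 (Suc i)) * ?L) = \<phi> * ?L * ?P (Transposition.transpose i (Suc d))"
      unfolding place_perm_last_to_first_conj[OF i, symmetric]
      by (rule assoc_mult_mat[symmetric, OF d\<phi> place_perm_carrier place_perm_carrier])
  qed simp
  also have "\<dots> = X_Res (Suc d) (schur_obj n (Suc d) M) (schur_E_iso n A d M \<psi>)"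
    unfolding X_Res_def \<psi>_eq schur_E_iso_adj[OF A d M \<phi>]
    by (simp add: schur_obj_def)
  finally show ?thesis .
qed

section \<open>Compatibility with \<open>T\<close>\<close>

text \<open>
  The permutation \<open>\<sigma>\<close> of \<open>{1..d}\<close> acting on the places \<open>{2..d + 1}\<close>, which are the old places after a
  factor has been added on the left.
\<close>

definition raise_perm :: "(nat \<Rightarrow> nat) \<Rightarrow> nat \<Rightarrow> nat" where
  "raise_perm \<sigma> k = (if k \<ge> 2 then Suc (\<sigma> (k - 1)) else k)"

lemma raise_perm_permutes:
  assumes "\<sigma> permutes {1..d}"
  shows "raise_perm \<sigma> permutes {1..Suc d}"
proof (rule permutes_of_inj_on)
  show "inj_on (raise_perm \<sigma>) {1..Suc d}"
  proof (rule inj_onI)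
    fix k l assume kl: "k \<in> {1..Suc d}" "l \<in> {1..Suc d}" "raise_perm \<sigma> k = raise_perm \<sigma> l"
    have "raise_perm \<sigma> k > 1 \<longleftrightarrow> k \<ge> 2" "raise_perm \<sigma> l > 1 \<longleftrightarrow> l \<ge> 2"
      using kl(1,2) permutes_in_image[OF assms, of "k - 1"] permutes_in_image[OF assms, of "l - 1"]
      by (auto simp: raise_perm_def)
    then show "k = l"
      using kl injD[OF permutes_inj[OF assms], of "k - 1" "l - 1"]
      by (cases "k \<ge> 2") (auto simp: raise_perm_def)
  qed
  show "raise_perm \<sigma> ` {1..Suc d} \<subseteq> {1..Suc d}"
    using permutes_in_image[OF assms] by (force simp: raise_perm_def)
  show "raise_perm \<sigma> k = k" if "k \<notin> {1..Suc d}" for k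
  proof (cases "k \<ge> 2")
    case True
    then have "k - 1 \<notin> {1..d}"
      using that by auto
    then show ?thesis
      using True permutes_not_in[OF assms] by (simp add: raise_perm_def)
  qed (simp add: raise_perm_def)
qed simp

lemma F_map_place_perm:
  assumes "\<sigma> permutes {1..d}"
  shows "F_map n (place_perm n d \<sigma>) = (place_perm n (Suc d) (raise_perm \<sigma>) :: 'a::field mat)"
proof -
  have "F_map n (place_perm n d \<sigma>) = kron (place_perm n 1 id) (place_perm n d \<sigma> :: 'a mat)"
    by (simp add: F_map_def place_perm_id)
  also have "\<dots> = place_perm n (1 + d) (raise_perm \<sigma>)"
    by (rule kron_place_perm[OF permutes_id assms]) (auto simp: raise_perm_def)
  finally show ?thesis
    by simp
qed

lemma T_F_tensor_power:
  "T_F n (tensor_power n d) =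
    (place_perm n (Suc (Suc d)) (Transposition.transpose 1 2) :: 'a::field mat)"
proof -
  have perm: "Transposition.transpose 1 2 permutes {1..2::nat}"
    by (rule permutes_swap_id) auto
  have "T_F n (tensor_power n d) =
      kron (place_perm n 2 (Transposition.transpose 1 2)) (place_perm n d id :: 'a mat)"
    by (simp add: T_F_def place_perm_id)
  also have "\<dots> = place_perm n (2 + d) (Transposition.transpose 1 2)"
    by (rule kron_place_perm[OF perm permutes_id]) (auto simp: Transposition.transpose_def)
  finally show ?thesis
    by simp
qed

text \<open>
  The inner application of the identification permutes the places of \<open>V\<^bsup>\<otimes>(d + 1)\<^esup>\<close>; naturality of the
  adjunction carries this permutation through the outer one, where \<open>F\<close> raises it.
\<close>

lemma schur_E2_iso_adj2:
  fixes A :: "'a::alg_closed_field adjunction"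
  assumes A: "right_adjoint_F n A" and d: "Suc (Suc d) \<le> n" and M: "M \<in> Rep n (Suc (Suc d))"
    and \<phi>: "\<phi> \<in> gl_hom n (F_obj n (F_obj n (tensor_power n d))) M"
  shows "schur_E2_iso n A d M (adj2 n A d (tensor_power n d) M \<phi>) =
    \<phi> * place_perm n (Suc (Suc d)) (raise_perm (last_to_first (Suc d)) \<circ> last_to_first (Suc (Suc d)))"
proof -
  let ?V = "tensor_power n d :: 'a gl_rep" and ?V' = "tensor_power n (Suc d) :: 'a gl_rep"
  let ?L = "place_perm n (Suc d) (last_to_first (Suc d)) :: 'a mat"
  let ?EM = "E_obj A (Suc d) M"
  have d': "Suc d \<le> n"
    using d by simp
  note V' = tensor_power_Rep[of n "Suc d", where 'a = 'a] and rat = Rep_rational[OF tensor_power_Rep]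
  have \<phi>': "\<phi> \<in> gl_hom n (F_obj n ?V') M"
    using \<phi> by simp
  have L: "?L \<in> gl_hom n ?V' ?V'"
    by (rule place_perm_gl_hom[OF last_to_first_permutes])
  have \<phi>L: "\<phi> * F_map n ?L \<in> gl_hom n (F_obj n ?V') M"
    by (rule gl_hom_mult[OF F_obj_rational[OF rat] F_obj_rational[OF rat] Rep_rational[OF M] \<phi>'
          gl_hom_F_map[OF rat rat L]])
  have "schur_E2_iso n A d M (adj2 n A d ?V M \<phi>) =
      schur_E_iso n A (Suc d) M (schur_E_iso n A d ?EM (adj A d ?V ?EM (adj A (Suc d) ?V' M \<phi>)))"
    by (simp add: schur_E2_iso_def adj2_def)
  also have "\<dots> = schur_E_iso n A (Suc d) M (adj A (Suc d) ?V' M \<phi> * ?L)"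
    using schur_E_iso_adj[OF A d' E_obj_Rep[OF A d M]] adj_gl_hom[OF A d V' M \<phi>'] by simp
  also have "\<dots> = schur_E_iso n A (Suc d) M (adj A (Suc d) ?V' M (\<phi> * F_map n ?L))"
    by (simp only: adj_natural[OF A d V' V' M L \<phi>'])
  also have "\<dots> = \<phi> * F_map n ?L * place_perm n (Suc (Suc d)) (last_to_first (Suc (Suc d)))"
    by (rule schur_E_iso_adj[OF A d M \<phi>L])
  also have "\<dots> = \<phi> * (place_perm n (Suc (Suc d)) (raise_perm (last_to_first (Suc d))) *
      place_perm n (Suc (Suc d)) (last_to_first (Suc (Suc d))))"
    unfolding F_map_place_perm[OF last_to_first_permutes]
    using gl_hom_carrier[OF \<phi>'] by (intro assoc_mult_mat[OF _ place_perm_carrier place_perm_carrier]) simp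
  finally show ?thesis
    by (simp only: place_perm_mult[OF raise_perm_permutes[OF last_to_first_permutes] last_to_first_permutes])
qed

text \<open>
  The composite sends the place \<open>d + 2\<close> to \<open>1\<close> and the place \<open>d + 1\<close> to \<open>2\<close>.
\<close>

lemma two_last_to_first_conj:
  "Transposition.transpose 1 2 \<circ> (raise_perm (last_to_first (Suc d)) \<circ> last_to_first (Suc (Suc d))) =
    raise_perm (last_to_first (Suc d)) \<circ> last_to_first (Suc (Suc d)) \<circ>
      Transposition.transpose (Suc d) (Suc (Suc d))"
  (is "?l = ?r")
proof
  fix k
  consider "k = 0" | "1 \<le> k" "k \<le> d" | "k = Suc d" | "k = Suc (Suc d)" | "k > Suc (Suc d)"
    by linarith
  then show "?l k = ?r k"
    by cases (simp_all add: raise_perm_def last_to_first_def Transposition.transpose_def, arith)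
qed

lemma schur_E2_iso_T:
  fixes A :: "'a::alg_closed_field adjunction"
  assumes A: "right_adjoint_F n A" and d: "Suc (Suc d) \<le> n" and M: "M \<in> Rep n (Suc (Suc d))"
    and \<psi>: "\<psi> \<in> carrier (schur_obj n d (E2_obj A d M))"
  shows "schur_E2_iso n A d M (schur_map (T_E n A d M) \<psi>) =
    T_Res (Suc (Suc d)) (schur_obj n (Suc (Suc d)) M) (schur_E2_iso n A d M \<psi>)"
proof -
  let ?V = "tensor_power n d :: 'a gl_rep"
  let ?P = "\<lambda>\<sigma>. place_perm n (Suc (Suc d)) \<sigma> :: 'a mat"
  let ?w = "raise_perm (last_to_first (Suc d)) \<circ> last_to_first (Suc (Suc d))"
  let ?s = "Transposition.transpose (Suc d) (Suc (Suc d))"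
  let ?t = "Transposition.transpose 1 2 :: nat \<Rightarrow> nat"
  note V = tensor_power_Rep[of n d, where 'a = 'a]
  note FV = F_obj_rational[OF F_obj_rational[OF Rep_rational[OF V]]]
  obtain \<phi> where \<phi>: "\<phi> \<in> gl_hom n (F_obj n (F_obj n ?V)) M" and \<psi>_eq: "\<psi> = adj2 n A d ?V M \<phi>"
    using \<psi> bij_betw_imp_surj_on[OF adj2_bij[OF A d V M]] by (auto simp: schur_obj_def)
  have d\<phi>: "\<phi> \<in> carrier_mat (rdim M) (n ^ Suc (Suc d))"
    using gl_hom_carrier[OF \<phi>] by simp
  have w: "?w permutes {1..Suc (Suc d)}"
    by (intro permutes_compose raise_perm_permutes last_to_first_permutes)
  have s: "?s permutes {1..Suc (Suc d)}" and t: "?t permutes {1..Suc (Suc d)}"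
    by (intro permutes_swap_id; simp)+
  have "schur_E2_iso n A d M (schur_map (T_E n A d M) \<psi>) =
      schur_E2_iso n A d M (adj2 n A d ?V M (\<phi> * T_F n ?V))"
    by (simp add: schur_map_def \<psi>_eq adj2_T_F[OF A d M V \<phi>])
  also have "\<dots> = \<phi> * T_F n ?V * ?P ?w"
    by (rule schur_E2_iso_adj2[OF A d M gl_hom_mult[OF FV FV Rep_rational[OF M] \<phi>
            T_F_gl_hom[OF Rep_rational[OF V]]]])
  also have "\<dots> = \<phi> * (?P ?t * ?P ?w)"
    unfolding T_F_tensor_power by (rule assoc_mult_mat[OF d\<phi> place_perm_carrier place_perm_carrier])
  also have "\<dots> = \<phi> * (?P ?w * ?P ?s)"
    by (simp only: place_perm_mult[OF t w] place_perm_mult[OF w s] two_last_to_first_conj)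
  also have "\<dots> = \<phi> * ?P ?w * ?P ?s"
    by (rule assoc_mult_mat[symmetric, OF d\<phi> place_perm_carrier place_perm_carrier])
  also have "\<dots> = T_Res (Suc (Suc d)) (schur_obj n (Suc (Suc d)) M) (schur_E2_iso n A d M \<psi>)"
    unfolding T_Res_def \<psi>_eq schur_E2_iso_adj2[OF A d M \<phi>] by (simp add: schur_obj_def)
  finally show ?thesis .
qed

theorem lemma7p5:
  fixes A :: "'a::alg_closed_field adjunction" and n p :: nat
  assumes "CHAR('a) = p" and "p > 2"
    and "right_adjoint_F n A"
  shows "(\<forall>d M. Suc d \<le> n \<longrightarrow> M \<in> Rep n (Suc d) \<longrightarrow>
            (\<forall>\<psi>\<in>carrier (schur_obj n d (E_obj A d M)).
               schur_E_iso n A d M (schur_map (X_E n A d M) \<psi>) =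
               X_Res (Suc d) (schur_obj n (Suc d) M) (schur_E_iso n A d M \<psi>)))
       \<and> (\<forall>d M. Suc (Suc d) \<le> n \<longrightarrow> M \<in> Rep n (Suc (Suc d)) \<longrightarrow>
            (\<forall>\<psi>\<in>carrier (schur_obj n d (E2_obj A d M)).
               schur_E2_iso n A d M (schur_map (T_E n A d M) \<psi>) =
               T_Res (Suc (Suc d)) (schur_obj n (Suc (Suc d)) M) (schur_E2_iso n A d M \<psi>)))"
  using schur_E_iso_X[OF assms(3)] schur_E2_iso_T[OF assms(3)] by blast

end
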